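(* Let $\mathbf g=(g_1,\dots,g_s)\subset\mathbb R[\mathbf X]$, $Q=\mathcal Q(\mathbf g)$ and $J=\sqrt[\mathbb R]{\operatorname{supp}Q}$. Then there exist $t,k\in\mathbb N$ with $t\le k$ such that for every $\sigma^*$ generic in $\mathcal L_{2k}(\mathbf g)$, the ideal of $\mathbb R[\mathbf X]$ generated by $\ker H^t_{\sigma^*}$ equals $J$.
   Context: $\mathbb R[\mathbf X]=\mathbb R[X_1,\dots,X_n]$; $\mathbb R[\mathbf X]_t$ is the space of polynomials of degree $\le t$. $\Sigma^2$ is the cone of sums of squares, $\Sigma^2_t=\Sigma^2\cap\mathbb R[\mathbf X]_t$. For a finite family $G$, $\mathcal Q_t(G)=\{s_0+\sum_{g\in G}s_g g: s_0\in\Sigma^2_t,\ s_g\in\Sigma^2,\ \deg s_g\le t-\deg g\}$ and $\mathcal Q(G)=\bigcup_t\mathcal Q_t(G)$. $\mathcal L_t(G)=\{\sigma\in(\mathbb R[\mathbf X]_t)^*:\sigma(q)\ge0\ \forall q\in\mathcal Q_t(G)\}$. $\operatorname{supp}Q=Q\cap(-Q)$; the real radical of an ideal $I$ is $\sqrt[\mathbb R]{I}=\{f:\exists m\in\mathbb N, s\in\Sigma^2, f^{2m}+s\in I\}$. For $\sigma\in(\mathbb R[\mathbf X]_r)^*$ and $2t\le r$, the Hankel operator $H^t_\sigma:\mathbb R[\mathbf X]_t\to(\mathbb R[\mathbf X]_t)^*$ is $H^t_\sigma(p)(q)=\sigma(pq)$; its kernel is a subspace of $\mathbb R[\mathbf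 X]_t$. For a set $C\subseteq(\mathbb R[\mathbf X]_{2k})^*$, an element $\sigma\in C$ is generic in $C$ if for every $s\le k$ and every $\eta\in C$, $\ker H^s_\sigma\subseteq\ker H^s_\eta$ (for convex cones $\mathcal L_{2k}(\mathbf g)$ this is equivalent to $H^k_\sigma$ having maximal rank). *)

theory Defs
  imports Complex_Main "HOL-Library.Poly_Mapping"
begin

text \<open>Real polynomials in finitely many variables indexed by the finite type 'n:
  a polynomial is a finitely supported map from monomials (exponent vectors, i.e. finitely supported
  maps from n to nat) to real coefficients; multiplication is convolution.\<close>

type_synonym 'n rpoly = "('n \<Rightarrow>\<^sub>0 nat) \<Rightarrow>\<^sub>0 real"

definition mdeg :: "('n::finite \<Rightarrow>\<^sub>0 nat) \<Rightarrow> nat" where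
  "mdeg m = (\<Sum>i\<in>UNIV. Poly_Mapping.lookup m i)"

definition tdeg :: "'n::finite rpoly \<Rightarrow> nat" where
  "tdeg p = (if p = 0 then 0 else Max (mdeg ` Poly_Mapping.keys p))"

definition cpoly :: "real \<Rightarrow> 'n::finite rpoly" where
  "cpoly c = Poly_Mapping.single 0 c"

definition polys_le :: "nat \<Rightarrow> 'n::finite rpoly set" where
  "polys_le t = {p. tdeg p \<le> t}"

definition is_sos :: "'n::finite rpoly \<Rightarrow> bool" where
  "is_sos s \<longleftrightarrow> (\<exists>ps. s = sum_list (map (\<lambda>p. p * p) ps))"

definition Qmod_t :: "nat \<Rightarrow> 'n::finite rpoly list \<Rightarrow> 'n rpoly set" where
  "Qmod_t t G = {q. \<exists>s0 s. is_sos s0 \<and> tdeg s0 \<le> t \<and>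
      (\<forall>i<length G. is_sos (s i) \<and> (s i = 0 \<or> tdeg (s i) + tdeg (G ! i) \<le> t)) \<and>
      q = s0 + (\<Sum>i<length G. s i * G ! i)}"

definition Qmod :: "'n::finite rpoly list \<Rightarrow> 'n rpoly set" where
  "Qmod G = (\<Union>t. Qmod_t t G)"

definition supp_set :: "'n::finite rpoly set \<Rightarrow> 'n rpoly set" where
  "supp_set Q = Q \<inter> uminus ` Q"

definition real_radical :: "'n::finite rpoly set \<Rightarrow> 'n rpoly set" where
  "real_radical I = {f. \<exists>m::nat. \<exists>s. is_sos s \<and> f ^ (2 * m) + s \<in> I}"

text \<open>Elements of the dual space (R[X]_t)^*, represented as real functions on polynomials
  that are linear on R[X]_t and vanish outside R[X]_t (canonical representative).\<close>
definition dual_t :: "nat \<Rightarrow> ('n::finite rpoly \<Rightarrow> real) set" where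
  "dual_t t = {\<sigma>. (\<forall>p\<in>polys_le t. \<forall>q\<in>polys_le t. \<sigma> (p + q) = \<sigma> p + \<sigma> q) \<and>
                 (\<forall>c. \<forall>p\<in>polys_le t. \<sigma> (cpoly c * p) = c * \<sigma> p) \<and>
                 (\<forall>p. p \<notin> polys_le t \<longrightarrow> \<sigma> p = 0)}"

definition Lcone_t :: "nat \<Rightarrow> 'n::finite rpoly list \<Rightarrow> ('n rpoly \<Rightarrow> real) set" where
  "Lcone_t t G = {\<sigma>\<in>dual_t t. \<forall>q\<in>Qmod_t t G. \<sigma> q \<ge> 0}"

definition hankel_ker :: "nat \<Rightarrow> ('n::finite rpoly \<Rightarrow> real) \<Rightarrow> 'n rpoly set" where
  "hankel_ker t \<sigma> = {p\<in>polys_le t. \<forall>q\<in>polys_le t. \<sigma> (p * q) = 0}"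

definition generic_in :: "nat \<Rightarrow> ('n::finite rpoly \<Rightarrow> real) set \<Rightarrow> ('n rpoly \<Rightarrow> real) \<Rightarrow> bool" where
  "generic_in k C \<sigma> \<longleftrightarrow> \<sigma> \<in> C \<and> (\<forall>s\<le>k. \<forall>\<eta>\<in>C. hankel_ker s \<sigma> \<subseteq> hankel_ker s \<eta>)"

definition ideal_gen :: "'n::finite rpoly set \<Rightarrow> 'n rpoly set" where
  "ideal_gen S = {f. \<exists>F c. finite F \<and> F \<subseteq> S \<and> f = (\<Sum>p\<in>F. c p * p)}"

end

theory Submission
  imports Defs "HOL-Analysis.Analysis" "HOL-Computational_Algebra.Primes"
begin

text \<open>Write \<open>Q\<close> for the quadratic module and \<open>J\<close> for the real radical of its support.

  If \<open>f \<in> J\<close> then \<open>- f ^ (2 ^ e) \<in> Q\<close> for some \<open>e\<close>, so every functional \<open>\<sigma>\<close> that is nonnegative on a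
  large enough truncation of \<open>Q\<close> satisfies \<open>\<sigma> (f ^ (2 ^ e)) = 0\<close>, and Cauchy-Schwarz descends to
  \<open>\<sigma> (f * q) = 0\<close>. Applied to finitely many generators of \<open>J\<close> this gives one inclusion.

  For the other one it suffices to find, for each \<open>k\<close>, one \<open>\<eta>\<close> in the cone such that \<open>\<eta> (f * f) = 0\<close> only for
  \<open>f \<in> J\<close>. Modulo \<open>J\<close> the truncated quadratic module is a pointed cone: \<open>J\<close> is convex with respect to \<open>Q\<close>,
  because \<open>1 - x\<close> has a square root when \<open>x\<close> is nilpotent. Parametrising the cone by positive semidefinite
  Gram matrices of trace one, which form a compact convex set with \<open>0\<close> not in its image, yields a
  strictly positive functional as the point of the image closest to \<open>0\<close>.\<close>

subsection \<open>Strictly positive functionals on cones of Gram matrices\<close>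

lemma nonneg_affine_imp_slope_zero:
  fixes a b :: real
  assumes "\<And>t. 0 \<le> 2 * t * a + b"
  shows "a = 0"
proof (rule ccontr)
  assume "a \<noteq> 0"
  then show False using assms[of "- (b + 1) / (2 * a)"] by (simp add: field_simps)
qed

lemma sum_square_insert:
  fixes M :: "'i \<Rightarrow> 'i \<Rightarrow> real"
  assumes "finite I" "a \<notin> I" "\<And>x. x \<in> I \<Longrightarrow> M x a = M a x"
  shows "(\<Sum>x\<in>insert a I. \<Sum>y\<in>insert a I. v x * v y * M x y) =
    v a * v a * M a a + 2 * v a * (\<Sum>y\<in>I. v y * M a y) + (\<Sum>x\<in>I. \<Sum>y\<in>I. v x * v y * M x y)"
proof -
  have "(\<Sum>x\<in>I. v x * v a * M x a) = v a * (\<Sum>y\<in>I. v y * M a y)"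
    by (simp add: sum_distrib_left assms(3) mult_ac)
  moreover have "(\<Sum>y\<in>I. v a * v y * M a y) = v a * (\<Sum>y\<in>I. v y * M a y)"
    by (simp add: sum_distrib_left mult_ac)
  ultimately show ?thesis
    using assms(1,2) by (simp add: sum.distrib)
qed

text \<open>Elimination of one index at a time: if the pivot \<open>M a a\<close> is positive, the
  Schur complement \<open>N\<close> is again positive semidefinite on \<open>I\<close>; if it is
  zero, positivity forces the whole row of \<open>a\<close> to vanish.\<close>

lemma psd_imp_gram:
  fixes M :: "'i \<Rightarrow> 'i \<Rightarrow> real"
  assumes "finite I" "\<And>x y. x \<in> I \<Longrightarrow> y \<in> I \<Longrightarrow> M x y = M y x"
    and "\<And>v. 0 \<le> (\<Sum>x\<in>I. \<Sum>y\<in>I. v x * v y * M x y)"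
  shows "\<exists>(n::nat) v. \<forall>x\<in>I. \<forall>y\<in>I. M x y = (\<Sum>j<n. v j x * v j y)"
  using assms
proof (induction I arbitrary: M rule: finite_induct)
  case empty
  then show ?case by simp
next
  case (insert a I M)
  define m where "m = M a a"
  define L where "L w = (\<Sum>y\<in>I. w y * M a y)" for w
  define q where "q w = (\<Sum>x\<in>I. \<Sum>y\<in>I. w x * w y * M x y)" for w
  have quad: "0 \<le> t * t * m + 2 * t * L w + q w" for t w
  proof -
    have "(\<Sum>x\<in>insert a I. \<Sum>y\<in>insert a I. (w(a := t)) x * (w(a := t)) y * M x y)
      = t * t * m + 2 * t * (\<Sum>y\<in>I. (w(a := t)) y * M a y)
        + (\<Sum>x\<in>I. \<Sum>y\<in>I. (w(a := t)) x * (w(a := t)) y * M x y)"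
      using sum_square_insert[OF insert.hyps, of M "w(a := t)"] insert.prems(1) by (simp add: m_def)
    also have "(\<Sum>y\<in>I. (w(a := t)) y * M a y) = L w"
      unfolding L_def using insert.hyps(2) by (intro sum.cong) auto
    also have "(\<Sum>x\<in>I. \<Sum>y\<in>I. (w(a := t)) x * (w(a := t)) y * M x y) = q w"
      unfolding q_def using insert.hyps(2) by (intro sum.cong refl) auto
    finally show ?thesis using insert.prems(2)[of "w(a := t)"] by simp
  qed
  have m0: "m \<ge> 0" using quad[of 1 "\<lambda>_. 0"] by (simp add: L_def q_def)
  show ?case
  proof (cases "m = 0")
    case True
    have La: "L w = 0" for w
      by (rule nonneg_affine_imp_slope_zero[of _ "q w"]) (use quad[of _ w] True in simp)
    have Ma: "M a x = 0" if "x \<in> I" for x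
    proof -
      have "L (\<lambda>y. if y = x then 1 else 0) = M a x"
        unfolding L_def using that insert.hyps(1)
        by (simp add: if_distrib[of "\<lambda>z. z * _"] cong: if_cong)
      then show ?thesis using La by simp
    qed
    have "\<exists>(n::nat) v. \<forall>x\<in>I. \<forall>y\<in>I. M x y = (\<Sum>j<n. v j x * v j y)"
      by (rule insert.IH) (use insert.prems(1) quad[of 0] in \<open>auto simp: q_def\<close>)
    then obtain n :: nat and v where v: "\<And>x y. x \<in> I \<Longrightarrow> y \<in> I \<Longrightarrow> M x y = (\<Sum>j<n. v j x * v j y)"
      by blast
    have Maa: "M a a = 0" using True by (simp add: m_def)
    have Mb: "M x a = 0" if "x \<in> I" for x using Ma[OF that] insert.prems(1)[of x a] that by simp
    have "\<forall>x\<in>insert a I. \<forall>y\<in>insert a I.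
        M x y = (\<Sum>j<n. ((v j)(a := 0)) x * ((v j)(a := 0)) y)"
    proof (intro ballI)
      fix x y assume xy: "x \<in> insert a I" "y \<in> insert a I"
      show "M x y = (\<Sum>j<n. ((v j)(a := 0)) x * ((v j)(a := 0)) y)"
      proof (cases "x = a \<or> y = a")
        case True
        then show ?thesis using xy Ma Mb Maa by auto
      next
        case False
        then show ?thesis using xy v[of x y] by simp
      qed
    qed
    then show ?thesis by (intro exI[of _ n] exI[of _ "\<lambda>j. (v j)(a := 0)"])
  next
    case False
    with m0 have mpos: "m > 0" by simp
    define N where "N x y = M x y - M a x * M a y / m" for x y
    have qN: "(\<Sum>x\<in>I. \<Sum>y\<in>I. w x * w y * N x y) = q w - L w * L w / m" for w
    proof -
      have "L w * L w / m = (\<Sum>x\<in>I. \<Sum>y\<in>I. w x * w y * (M a x * M a y / m))"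
        unfolding L_def sum_product sum_divide_distrib by (simp add: mult_ac)
      then show ?thesis unfolding N_def q_def by (simp add: right_diff_distrib sum_subtractf)
    qed
    have "\<exists>(n::nat) v. \<forall>x\<in>I. \<forall>y\<in>I. N x y = (\<Sum>j<n. v j x * v j y)"
    proof (rule insert.IH)
      show "N x y = N y x" if "x \<in> I" "y \<in> I" for x y
        using insert.prems(1)[of x y] that by (simp add: N_def)
      \<comment> \<open>The choice \<open>t = - L w / m\<close> minimises the quadratic in
        \<open>t\<close>, and the minimum is exactly the form of \<open>N\<close>.\<close>
      show "0 \<le> (\<Sum>x\<in>I. \<Sum>y\<in>I. w x * w y * N x y)" for w
        using quad[of "- L w / m" w] mpos unfolding qN by (simp add: field_simps)
    qed
    then obtain n :: nat and v where v: "\<And>x y. x \<in> I \<Longrightarrow> y \<in> I \<Longrightarrow> N x y = (\<Sum>j<n. v j x * v j y)"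
      by blast
    \<comment> \<open>The extra vector, at index \<open>n\<close>, is the pivot row scaled by
      \<open>1 / sqrt m\<close>. The old vectors are reset to zero at \<open>a\<close>, where the
      induction hypothesis does not control them.\<close>
    define u where "u j = (if j < n then (v j)(a := 0) else (\<lambda>x. M a x / sqrt m))" for j
    have su: "(\<Sum>j<Suc n. u j x * u j y) = (\<Sum>j<n. ((v j)(a := 0)) x * ((v j)(a := 0)) y)
        + M a x * M a y / m" for x y
    proof -
      have "sqrt m * sqrt m = m" using mpos by simp
      then show ?thesis by (simp add: u_def)
    qed
    have Mxy: "M x y = N x y + M a x * M a y / m" for x y by (simp add: N_def)
    have Maa: "M a a = m" by (simp add: m_def)
    have sym: "M x a = M a x" if "x \<in> I" for x using insert.prems(1)[of x a] that by simp
    have "\<forall>x\<in>insert a I. \<forall>y\<in>insert a I. M x y = (\<Sum>j<Suc n. u j x * u j y)"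
    proof (intro ballI)
      fix x y assume xy: "x \<in> insert a I" "y \<in> insert a I"
      show "M x y = (\<Sum>j<Suc n. u j x * u j y)"
      proof -
        consider "x = a" | "x \<in> I" "y = a" | "x \<in> I" "y \<in> I" "x \<noteq> a" "y \<noteq> a"
          using xy insert.hyps(2) by blast
        then show ?thesis
        proof cases
          case 1
          then show ?thesis unfolding su using Maa mpos by simp
        next
          case 2
          then have "M x y = M a x * M a y / m" using sym[of x] Maa mpos by simp
          with 2 show ?thesis unfolding su by simp
        next
          case 3
          then show ?thesis unfolding su using v[of x y] Mxy[of x y] by simp
        qed
      qed
    qed
    then show ?thesis by blast
  qed
qed


text \<open>The functional is the inner product over \<open>B\<close> with the point
  \<open>\<Psi> M\<close> of least norm. Assumption \<open>pointed\<close> says that a sum of values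
  of the quadratic map given by \<open>T\<close> vanishes only trivially: the cone is pointed and no
  nonzero vector is sent to zero.\<close>

lemma strictly_positive_functional:
  fixes T :: "'i \<Rightarrow> 'i \<Rightarrow> 'b \<Rightarrow> real"
  assumes fin: "finite I" "finite B"
    and pointed: "\<And>(n::nat) v. (\<And>b. b \<in> B \<Longrightarrow> (\<Sum>j<n. \<Sum>x\<in>I. \<Sum>y\<in>I. v j x * v j y * T x y b) = 0)
      \<Longrightarrow> \<forall>j<n. \<forall>x\<in>I. v j x = 0"
  shows "\<exists>\<sigma>. \<forall>v. (\<exists>x\<in>I. v x \<noteq> 0) \<longrightarrow>
    0 < (\<Sum>b\<in>B. \<sigma> b * (\<Sum>x\<in>I. \<Sum>y\<in>I. v x * v y * T x y b))"
proof (cases "I = {}")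
  case True
  then show ?thesis by simp
next
  case False
  define \<Psi> :: "('i \<times> 'i \<Rightarrow> real) \<Rightarrow> 'b \<Rightarrow> real"
    where "\<Psi> M b = (\<Sum>x\<in>I. \<Sum>y\<in>I. M (x, y) * T x y b)" for M b
  define F where "F M = (\<Sum>b\<in>B. \<Psi> M b * \<Psi> M b)" for M
  \<comment> \<open>The index type may be infinite, so compactness comes from Tychonoff; the bounds
    on the entries belong to the definition for that reason.\<close>
  define D :: "('i \<times> 'i \<Rightarrow> real) set" where
    "D = {M. (\<forall>z. M z \<in> {-1..1}) \<and> (\<forall>x y. M (x, y) = M (y, x)) \<and>
       (\<forall>v. 0 \<le> (\<Sum>x\<in>I. \<Sum>y\<in>I. v x * v y * M (x, y))) \<and> (\<Sum>x\<in>I. M (x, x)) = 1}"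
  \<comment> \<open>Rank-one matrices scaled to trace one; the arithmetic-geometric mean inequality
    keeps their entries in the cube.\<close>
  define R :: "('i \<Rightarrow> real) \<Rightarrow> 'i \<times> 'i \<Rightarrow> real" where
    "R v = (\<lambda>(x, y). if x \<in> I \<and> y \<in> I then v x * v y / (\<Sum>z\<in>I. v z * v z) else 0)" for v
  have R_D: "R v \<in> D" if v: "\<exists>x\<in>I. v x \<noteq> 0" for v
  proof -
    define S where "S = (\<Sum>z\<in>I. v z * v z)"
    have S: "S > 0"
    proof -
      obtain x where "x \<in> I" "v x \<noteq> 0" using v by blast
      then show ?thesis unfolding S_def using fin(1)
        by (intro sum_pos2[of I x]) (auto simp: zero_less_mult_iff)
    qed
    have "\<bar>v x * v y\<bar> \<le> S" if "x \<in> I" "y \<in> I" for x y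
    proof (cases "x = y")
      case True
      then show ?thesis unfolding S_def using that fin(1)
        using member_le_sum[of x I "\<lambda>z. v z * v z"] by (simp add: abs_mult_self_eq)
    next
      case False
      have "(\<Sum>z\<in>{x, y}. v z * v z) \<le> S"
        unfolding S_def using that fin(1) by (intro sum_mono2) auto
      moreover have "2 * \<bar>v x * v y\<bar> \<le> v x * v x + v y * v y"
        using sum_squares_bound[of "\<bar>v x\<bar>" "\<bar>v y\<bar>"] by (simp add: power2_eq_square abs_mult)
      moreover have "0 \<le> v x * v x + v y * v y" by simp
      ultimately show ?thesis using False by simp
    qed
    then have bd: "R v z \<in> {-1..1}" for z
      using S by (cases z) (auto simp: R_def S_def[symmetric] divide_le_eq le_divide_eq abs_le_iff
          minus_le_iff)
    have "(\<Sum>x\<in>I. \<Sum>y\<in>I. w x * w y * R v (x, y)) = (\<Sum>x\<in>I. w x * v x) * (\<Sum>x\<in>I. w x * v x) / S" for w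
      unfolding sum_product sum_divide_distrib by (intro sum.cong) (auto simp: R_def S_def)
    then have psd: "0 \<le> (\<Sum>x\<in>I. \<Sum>y\<in>I. w x * w y * R v (x, y))" for w
      using S by simp
    have "(\<Sum>x\<in>I. R v (x, x)) = (\<Sum>x\<in>I. v x * v x / S)"
      by (simp add: R_def S_def)
    also have "\<dots> = (\<Sum>x\<in>I. v x * v x) / S" by (simp only: sum_divide_distrib)
    finally have "(\<Sum>x\<in>I. R v (x, x)) = S / S" by (simp only: S_def)
    then have tr: "(\<Sum>x\<in>I. R v (x, x)) = 1" using S by simp
    have "R v (x, y) = R v (y, x)" for x y by (simp add: R_def mult.commute)
    then show ?thesis unfolding D_def using bd psd tr by blast
  qed
  have cont: "continuous_on UNIV (\<lambda>M :: 'i \<times> 'i \<Rightarrow> real. M z)" for z by simp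
  have "compact {M :: 'i \<times> 'i \<Rightarrow> real. \<forall>z. M z \<in> {-1..1}}"
  proof -
    have "compactin (product_topology (\<lambda>_::'i \<times> 'i. euclidean) UNIV) (PiE UNIV (\<lambda>_. {-1..1::real}))"
      by (subst compactin_PiE) auto
    then show ?thesis by (simp add: euclidean_product_topology PiE_def Pi_def)
  qed
  moreover have "closed {M :: 'i \<times> 'i \<Rightarrow> real. \<forall>x y. M (x, y) = M (y, x)}"
    by (intro closed_Collect_all closed_Collect_eq) (simp_all add: cont)
  moreover have "closed {M :: 'i \<times> 'i \<Rightarrow> real. \<forall>v. 0 \<le> (\<Sum>x\<in>I. \<Sum>y\<in>I. v x * v y * M (x, y))}"
    by (intro closed_Collect_all closed_Collect_le continuous_intros) (simp_all add: cont)
  moreover have "closed {M :: 'i \<times> 'i \<Rightarrow> real. (\<Sum>x\<in>I. M (x, x)) = 1}"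
    by (intro closed_Collect_eq continuous_intros) (simp_all add: cont)
  moreover have "D = {M. \<forall>z. M z \<in> {-1..1}} \<inter> ({M. \<forall>x y. M (x, y) = M (y, x)} \<inter>
      ({M. \<forall>v. 0 \<le> (\<Sum>x\<in>I. \<Sum>y\<in>I. v x * v y * M (x, y))} \<inter> {M. (\<Sum>x\<in>I. M (x, x)) = 1}))"
    unfolding D_def by blast
  ultimately have "compact D"
    by (simp only: compact_Int_closed closed_Int)
  moreover have "D \<noteq> {}" using R_D[of "\<lambda>_. 1"] \<open>I \<noteq> {}\<close> by auto
  moreover have "continuous_on D F"
    unfolding F_def \<Psi>_def
    by (intro continuous_intros continuous_on_subset[OF cont]) simp_all
  ultimately obtain M where M: "M \<in> D" and least: "\<And>N. N \<in> D \<Longrightarrow> F M \<le> F N"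
    using continuous_attains_inf[of D F] by blast
  \<comment> \<open>If the minimum were zero, a Gram decomposition of \<open>M\<close> would exhibit
    a vanishing sum of values of the quadratic map, and \<open>pointed\<close> would make the trace
    of \<open>M\<close> zero.\<close>
  have FM: "F M > 0"
  proof (rule ccontr)
    assume "\<not> F M > 0"
    moreover have "F M \<ge> 0" unfolding F_def by (simp add: sum_nonneg)
    ultimately have "F M = 0" by simp
    then have \<Psi>0: "\<Psi> M b = 0" if "b \<in> B" for b
      using that fin(2) by (simp add: F_def sum_nonneg_eq_0_iff)
    have "\<exists>(n::nat) v. \<forall>x\<in>I. \<forall>y\<in>I. M (x, y) = (\<Sum>j<n. v j x * v j y)"
      by (rule psd_imp_gram[where M = "\<lambda>x y. M (x, y)"]) (use fin(1) M in \<open>auto simp: D_def\<close>)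
    then obtain n :: nat and v
      where v: "\<And>x y. x \<in> I \<Longrightarrow> y \<in> I \<Longrightarrow> M (x, y) = (\<Sum>j<n. v j x * v j y)" by blast
    have "(\<Sum>j<n. \<Sum>x\<in>I. \<Sum>y\<in>I. v j x * v j y * T x y b) = \<Psi> M b" for b
    proof -
      have "(\<Sum>j<n. \<Sum>x\<in>I. \<Sum>y\<in>I. v j x * v j y * T x y b)
        = (\<Sum>x\<in>I. \<Sum>j<n. \<Sum>y\<in>I. v j x * v j y * T x y b)"
        by (rule sum.swap)
      also have "\<dots> = (\<Sum>x\<in>I. \<Sum>y\<in>I. \<Sum>j<n. v j x * v j y * T x y b)"
        by (intro sum.cong refl sum.swap)
      also have "\<dots> = \<Psi> M b"
        unfolding \<Psi>_def by (intro sum.cong refl) (simp add: v sum_distrib_right)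
      finally show ?thesis .
    qed
    with pointed[where n = n and v = v] \<Psi>0 have "\<forall>j<n. \<forall>x\<in>I. v j x = 0" by simp
    then have "(\<Sum>x\<in>I. M (x, x)) = 0" by (simp add: v)
    with M show False by (simp add: D_def)
  qed
  \<comment> \<open>Variational inequality for the nearest point of a convex set: compare
    \<open>M\<close> with \<open>(1 - t) * M + t * N\<close>, divide by \<open>t\<close> and take
    \<open>t\<close> small.\<close>
  have pos: "F M \<le> (\<Sum>b\<in>B. \<Psi> M b * \<Psi> N b)" if N: "N \<in> D" for N
  proof -
    define c where "c = (\<Sum>b\<in>B. \<Psi> M b * \<Psi> N b)"
    have "2 * (c - F M) + t * (F M + F N - 2 * c) \<ge> 0" if t: "0 < t" "t \<le> 1" for t
    proof -
      define K where "K z = (1 - t) * M z + t * N z" for z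
      have "K \<in> D"
      proof -
        have "(\<Sum>x\<in>I. \<Sum>y\<in>I. v x * v y * K (x, y)) = (1 - t) * (\<Sum>x\<in>I. \<Sum>y\<in>I. v x * v y * M (x, y))
           + t * (\<Sum>x\<in>I. \<Sum>y\<in>I. v x * v y * N (x, y))" for v
          unfolding K_def sum_distrib_left sum.distrib[symmetric]
          by (intro sum.cong refl) (simp add: algebra_simps)
        then have "0 \<le> (\<Sum>x\<in>I. \<Sum>y\<in>I. v x * v y * K (x, y))" for v
          using t M N by (simp add: D_def)
        moreover have "K z \<in> {-1..1}" for z
        proof -
          have "M z \<in> {-1..1}" "N z \<in> {-1..1}" using M N unfolding D_def by blast+
          then have "\<bar>M z\<bar> \<le> 1" "\<bar>N z\<bar> \<le> 1" by auto
          then have "\<bar>(1 - t) * M z\<bar> \<le> 1 - t" "\<bar>t * N z\<bar> \<le> t"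
            using t by (auto simp: abs_mult intro: mult_left_le)
          then show ?thesis unfolding K_def by auto
        qed
        moreover have "(\<Sum>x\<in>I. K (x, x)) = (1 - t) * (\<Sum>x\<in>I. M (x, x)) + t * (\<Sum>x\<in>I. N (x, x))"
          unfolding K_def by (simp add: sum.distrib sum_distrib_left)
        moreover have "(\<Sum>x\<in>I. M (x, x)) = 1" "(\<Sum>x\<in>I. N (x, x)) = 1" using M N unfolding D_def by blast+
        moreover have "K (x, y) = K (y, x)" for x y
        proof -
          have "M (x, y) = M (y, x)" "N (x, y) = N (y, x)" using M N unfolding D_def by blast+
          then show ?thesis by (simp add: K_def)
        qed
        ultimately show ?thesis by (simp add: D_def)
      qed
      have \<Psi>K: "\<Psi> K b = (1 - t) * \<Psi> M b + t * \<Psi> N b" for b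
        unfolding K_def \<Psi>_def sum_distrib_left sum.distrib[symmetric]
        by (intro sum.cong refl) (simp add: algebra_simps)
      have "F K = (1 - t) * (1 - t) * F M + 2 * t * (1 - t) * c + t * t * F N"
        unfolding F_def c_def sum_distrib_left sum.distrib[symmetric]
        by (intro sum.cong refl) (simp only: \<Psi>K, simp add: algebra_simps)
      with least[OF \<open>K \<in> D\<close>]
      have "0 \<le> t * (2 * (c - F M) + t * (F M + F N - 2 * c))" by (simp add: algebra_simps)
      then show ?thesis using t by (simp add: zero_le_mult_iff)
    qed
    note ineq = this
    have "F M \<le> c"
    proof (rule ccontr)
      assume "\<not> F M \<le> c"
      then have e: "F M - c > 0" by simp
      \<comment> \<open>The step \<open>(F M - c) / h\<close> is at most one and so short that the
        second-order term costs at most \<open>F M - c\<close>, half of the first-order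
        gain.\<close>
      define h where "h = \<bar>F M + F N - 2 * c\<bar> + 1 + (F M - c)"
      have h: "h > 0" "F M - c \<le> h" "F M + F N - 2 * c \<le> h" using e by (auto simp: h_def)
      have "(F M - c) / h * (F M + F N - 2 * c) \<le> (F M - c) / h * h"
        using h e by (intro mult_left_mono) auto
      also have "\<dots> = F M - c" using h by simp
      finally have "(F M - c) / h * (F M + F N - 2 * c) \<le> F M - c" .
      moreover have "0 \<le> 2 * (c - F M) + (F M - c) / h * (F M + F N - 2 * c)"
        by (rule ineq) (use h e in auto)
      ultimately have "0 \<le> 2 * (c - F M) + (F M - c)" by (meson add_left_mono order_trans)
      then show False using e by simp
    qed
    then show ?thesis by (simp add: c_def)
  qed
  show ?thesis
  proof (intro exI[of _ "\<Psi> M"] allI impI)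
    fix v assume v: "\<exists>x\<in>I. v x \<noteq> (0::real)"
    define S where "S = (\<Sum>z\<in>I. v z * v z)"
    have S: "S > 0"
    proof -
      obtain x where "x \<in> I" "v x \<noteq> 0" using v by blast
      then show ?thesis unfolding S_def using fin(1)
        by (intro sum_pos2[of I x]) (auto simp: zero_less_mult_iff)
    qed
    \<comment> \<open>By homogeneity it suffices to evaluate at the normalised matrix
      \<open>R v\<close>.\<close>
    have "(\<Sum>x\<in>I. \<Sum>y\<in>I. v x * v y * T x y b) = S * \<Psi> (R v) b" for b
      unfolding \<Psi>_def sum_distrib_left using S by (intro sum.cong refl) (simp add: R_def S_def)
    then have "(\<Sum>b\<in>B. \<Psi> M b * (\<Sum>x\<in>I. \<Sum>y\<in>I. v x * v y * T x y b)) = S * (\<Sum>b\<in>B. \<Psi> M b * \<Psi> (R v) b)"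
      by (simp add: sum_distrib_left mult_ac)
    moreover have "(\<Sum>b\<in>B. \<Psi> M b * \<Psi> (R v) b) > 0"
      using pos[OF R_D[OF v]] FM by simp
    ultimately show "0 < (\<Sum>b\<in>B. \<Psi> M b * (\<Sum>x\<in>I. \<Sum>y\<in>I. v x * v y * T x y b))"
      using S by simp
  qed
qed

subsection \<open>Coefficients and degrees\<close>

lemma lookup_cpoly_mult [simp]:
  "Poly_Mapping.lookup (cpoly c * p) m = c * Poly_Mapping.lookup p m"
  unfolding cpoly_def mult_map_scale_conv_mult[symmetric]
  by (simp add: Poly_Mapping.map.rep_eq when_def)

lemma cpoly_simps [simp]: "cpoly 0 = 0" "cpoly 1 = 1"
  by (simp_all add: cpoly_def)

lemma cpoly_add: "cpoly (a + b) = cpoly a + cpoly b"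
  by (simp add: cpoly_def single_add)

lemma cpoly_mult: "cpoly (a * b) = cpoly a * cpoly b"
  by (simp add: cpoly_def mult_single)

lemma cpoly_half: "cpoly (1/2) + cpoly (1/2) = (1 :: 'n::finite rpoly)"
  by (simp add: cpoly_add[symmetric])

lemma cpoly_minus_one_mult: "cpoly (- 1) * p = - p"
  by (rule poly_mapping_eqI) simp

lemma cpoly_mult_single:
  "cpoly c * Poly_Mapping.single m d = Poly_Mapping.single m (c * d)"
  by (simp add: cpoly_def mult_single)

lemma sum_singles:
  fixes p :: "'n::finite rpoly"
  shows "(\<Sum>m\<in>Poly_Mapping.keys p. Poly_Mapping.single m (Poly_Mapping.lookup p m)) = p"
proof (rule poly_mapping_eqI)
  fix k
  have "(\<Sum>m\<in>Poly_Mapping.keys p. Poly_Mapping.lookup p m when m = k) = Poly_Mapping.lookup p k"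
    by (simp add: when_def in_keys_iff)
  then show "Poly_Mapping.lookup (\<Sum>m\<in>Poly_Mapping.keys p. Poly_Mapping.single m (Poly_Mapping.lookup p m)) k
      = Poly_Mapping.lookup p k"
    by (simp add: lookup_sum lookup_single)
qed

text \<open>Uniqueness of the decomposition of \<open>m + n\<close> rules out cancellation. This
  gives extreme coefficients both of squares and of monomial multiples.\<close>

lemma lookup_mult_unique:
  fixes p q :: "'n::finite rpoly"
  assumes "\<And>a b. a \<in> Poly_Mapping.keys p \<Longrightarrow> b \<in> Poly_Mapping.keys q \<Longrightarrow> a + b = m + n \<Longrightarrow> a = m \<and> b = n"
  shows "Poly_Mapping.lookup (p * q) (m + n) = Poly_Mapping.lookup p m * Poly_Mapping.lookup q n"
proof -
  let ?p = "Poly_Mapping.lookup p" and ?q = "Poly_Mapping.lookup q"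
  have "p * q = (\<Sum>a\<in>Poly_Mapping.keys p. \<Sum>b\<in>Poly_Mapping.keys q. Poly_Mapping.single (a + b) (?p a * ?q b))"
  proof -
    have "p * q = (\<Sum>a\<in>Poly_Mapping.keys p. Poly_Mapping.single a (?p a))
        * (\<Sum>b\<in>Poly_Mapping.keys q. Poly_Mapping.single b (?q b))"
      by (simp only: sum_singles)
    then show ?thesis by (simp only: sum_product mult_single)
  qed
  then have "Poly_Mapping.lookup (p * q) (m + n) =
    (\<Sum>a\<in>Poly_Mapping.keys p. \<Sum>b\<in>Poly_Mapping.keys q. if a + b = m + n then ?p a * ?q b else 0)"
    by (simp add: lookup_sum lookup_single when_def)
  also have "\<dots> = (\<Sum>a\<in>Poly_Mapping.keys p. \<Sum>b\<in>Poly_Mapping.keys q.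
      if a = m then if b = n then ?p m * ?q n else 0 else 0)"
    by (intro sum.cong refl) (use assms in auto)
  also have "\<dots> = (\<Sum>a\<in>Poly_Mapping.keys p. if a = m then ?p m * ?q n else 0)"
    by (intro sum.cong refl) (auto simp: in_keys_iff)
  also have "\<dots> = ?p m * ?q n"
    by (auto simp: in_keys_iff)
  finally show ?thesis .
qed

lemma mdeg_add: "mdeg (a + b) = mdeg a + mdeg b"
  by (simp add: mdeg_def lookup_add sum.distrib)

lemma tdeg_le_iff: "tdeg p \<le> t \<longleftrightarrow> (\<forall>m\<in>Poly_Mapping.keys p. mdeg m \<le> t)"
  by (cases "p = 0") (auto simp: tdeg_def)

lemma tdeg_0 [simp]: "tdeg 0 = 0"
  by (simp add: tdeg_def)

lemma tdeg_1 [simp]: "tdeg 1 = 0"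
  using tdeg_le_iff[of 1 0] by (simp add: mdeg_def)

lemma tdeg_add_le: "tdeg p \<le> t \<Longrightarrow> tdeg q \<le> t \<Longrightarrow> tdeg (p + q) \<le> t"
  unfolding tdeg_le_iff using keys_add[of p q] by blast

lemma tdeg_uminus [simp]: "tdeg (- p) = tdeg p"
proof -
  have "Poly_Mapping.keys (- p) = Poly_Mapping.keys p" by (auto simp: in_keys_iff)
  then show ?thesis by (auto simp: tdeg_def)
qed

lemma tdeg_diff_le: "tdeg p \<le> t \<Longrightarrow> tdeg q \<le> t \<Longrightarrow> tdeg (p - q) \<le> t"
  using tdeg_add_le[of p t "- q"] by simp

lemma tdeg_mult_le: "tdeg (p * q) \<le> tdeg p + tdeg q"
  unfolding tdeg_le_iff
proof
  fix m assume "m \<in> Poly_Mapping.keys (p * q)"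
  then obtain a b where "m = a + b" "a \<in> Poly_Mapping.keys p" "b \<in> Poly_Mapping.keys q"
    using keys_mult[of p q] by blast
  then show "mdeg m \<le> tdeg p + tdeg q"
    using tdeg_le_iff[of p "tdeg p"] tdeg_le_iff[of q "tdeg q"] by (simp add: mdeg_add add_mono)
qed

lemma tdeg_cpoly_mult_le: "tdeg (cpoly c * p) \<le> tdeg p"
proof -
  have "Poly_Mapping.keys (cpoly c * p) \<subseteq> Poly_Mapping.keys p" by (auto simp: in_keys_iff)
  then show ?thesis using tdeg_le_iff[of p "tdeg p"] unfolding tdeg_le_iff[of "cpoly c * p"] by blast
qed

lemma tdeg_sum_le: "(\<And>i. i \<in> A \<Longrightarrow> tdeg (p i) \<le> t) \<Longrightarrow> tdeg (\<Sum>i\<in>A. p i) \<le> t"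
proof (induction A rule: infinite_finite_induct)
  case (insert x A)
  then show ?case by (simp add: tdeg_add_le)
qed simp_all

lemma tdeg_power_le: "tdeg (p ^ n) \<le> n * tdeg p"
proof (induction n)
  case (Suc n)
  then show ?case using tdeg_mult_le[of p "p ^ n"] by simp
qed simp

lemma finite_mdeg_le: "finite {m :: 'n::finite \<Rightarrow>\<^sub>0 nat. mdeg m \<le> t}"
proof -
  have "Poly_Mapping.lookup ` {m :: 'n \<Rightarrow>\<^sub>0 nat. mdeg m \<le> t} \<subseteq> PiE UNIV (\<lambda>_. {..t})"
  proof
    fix f assume "f \<in> Poly_Mapping.lookup ` {m :: 'n \<Rightarrow>\<^sub>0 nat. mdeg m \<le> t}"
    then obtain m :: "'n \<Rightarrow>\<^sub>0 nat" where f: "f = Poly_Mapping.lookup m" "mdeg m \<le> t" by blast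
    have "Poly_Mapping.lookup m i \<le> mdeg m" for i
      unfolding mdeg_def by (rule member_le_sum) auto
    with f show "f \<in> PiE UNIV (\<lambda>_. {..t})" using le_trans by (fastforce simp: PiE_def)
  qed
  moreover have "finite (PiE (UNIV :: 'n set) (\<lambda>_. {..t}))" by (intro finite_PiE) auto
  ultimately have "finite (Poly_Mapping.lookup ` {m :: 'n \<Rightarrow>\<^sub>0 nat. mdeg m \<le> t})"
    by (rule finite_subset)
  then show ?thesis by (rule finite_imageD) (simp add: inj_on_def lookup_inject)
qed

subsection \<open>A monomial order\<close>

lemma ex_monomial_key:
  "\<exists>\<kappa> :: ('n::finite \<Rightarrow>\<^sub>0 nat) \<Rightarrow> nat. inj \<kappa> \<and> (\<forall>a b. \<kappa> (a + b) = \<kappa> a * \<kappa> b) \<and> (\<forall>a. 0 < \<kappa> a)"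
proof -
  obtain h :: "'n \<Rightarrow> nat" where h: "inj h"
    using finite_imp_inj_to_nat_seg[of "UNIV :: 'n set"] by auto
  define f where "f = enumerate {p :: nat. prime p} \<circ> h"
  have inf: "infinite {p :: nat. prime p}" by (rule primes_infinite)
  have f: "inj f" "\<And>i. prime (f i)"
    using h strict_mono_enumerate[OF inf] enumerate_in_set[OF inf]
    by (auto simp: f_def intro: inj_compose strict_mono_imp_inj_on)
  define \<kappa> :: "('n \<Rightarrow>\<^sub>0 nat) \<Rightarrow> nat" where "\<kappa> m = (\<Prod>i\<in>UNIV. f i ^ Poly_Mapping.lookup m i)" for m
  \<comment> \<open>Unique factorisation recovers each exponent as the multiplicity of its prime,
    whence injectivity.\<close>
  have mult: "multiplicity (f i) (\<kappa> m) = Poly_Mapping.lookup m i" for i m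
  proof -
    have "\<kappa> m = (\<Prod>p\<in>range f. p ^ Poly_Mapping.lookup m (inv f p))"
      by (simp add: \<kappa>_def prod.reindex[OF f(1)] f(1))
    then show ?thesis
      using multiplicity_prod_prime_powers[of "range f" "f i" "\<lambda>p. Poly_Mapping.lookup m (inv f p)"] f
      by auto
  qed
  have "inj \<kappa>"
    by (rule injI, rule poly_mapping_eqI) (metis mult)
  moreover have "\<kappa> (a + b) = \<kappa> a * \<kappa> b" for a b
    by (simp add: \<kappa>_def lookup_add power_add prod.distrib)
  moreover have "0 < \<kappa> a" for a
    unfolding \<kappa>_def using f(2) by (auto intro!: prod_pos simp: prime_gt_0_nat)
  ultimately show ?thesis by blast
qed

text \<open>Pulling back the order of the natural numbers along \<open>x\<^sup>a \<mapsto> \<Prod>\<^sub>i p\<^sub>i ^ a\<^sub>i\<close>, with distinct primes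
  \<open>p\<^sub>i\<close>, gives a monomial order, so that no order on the variables is needed.\<close>

definition mkey :: "('n::finite \<Rightarrow>\<^sub>0 nat) \<Rightarrow> nat" where
  "mkey = (SOME \<kappa>. inj \<kappa> \<and> (\<forall>a b. \<kappa> (a + b) = \<kappa> a * \<kappa> b) \<and> (\<forall>a. 0 < \<kappa> a))"

lemma mkey_spec:
  "inj (mkey :: ('n::finite \<Rightarrow>\<^sub>0 nat) \<Rightarrow> nat) \<and>
    (\<forall>a b :: 'n \<Rightarrow>\<^sub>0 nat. mkey (a + b) = mkey a * mkey b) \<and> (\<forall>a :: 'n \<Rightarrow>\<^sub>0 nat. 0 < mkey a)"
  unfolding mkey_def by (rule someI_ex[OF ex_monomial_key])

lemma mkey_inj: "inj mkey"
  using mkey_spec by (rule conjunct1)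

lemma mkey_add: "mkey (a + b) = mkey a * mkey b"
  using mkey_spec[THEN conjunct2, THEN conjunct1, THEN spec, THEN spec] .

lemma mkey_pos: "0 < mkey a"
  using mkey_spec[THEN conjunct2, THEN conjunct2] by (rule spec)

text \<open>By multiplicativity the equation becomes one between products of positive numbers, which
  fails as soon as one factor drops.\<close>

lemma mkey_le_add_unique:
  assumes "mkey a \<le> mkey m" "mkey b \<le> mkey n" "a + b = m + n"
  shows "a = m \<and> b = n"
proof -
  have eq: "mkey a * mkey b = mkey m * mkey n" using assms(3) by (metis mkey_add)
  have "mkey a = mkey m"
  proof (rule ccontr)
    assume "mkey a \<noteq> mkey m"
    then have "mkey a * mkey b < mkey m * mkey b" using assms(1) mkey_pos[of b] by simp
    also have "\<dots> \<le> mkey m * mkey n" using assms(2) by simp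
    finally show False using eq by simp
  qed
  then have "a = m" by (rule injD[OF mkey_inj])
  then show ?thesis using assms(3) by simp
qed

text \<open>The square of the \<open>mkey\<close>-largest monomial of top degree has a positive coefficient.\<close>

lemma tdeg_sum_squares_ge:
  fixes p :: "nat \<Rightarrow> 'n::finite rpoly"
  assumes j: "j < n"
  shows "2 * tdeg (p j) \<le> tdeg (\<Sum>j<n. p j * p j)"
proof (cases "p j = 0")
  case True
  then show ?thesis by simp
next
  case False
  define K where "K = (\<Union>j<n. Poly_Mapping.keys (p j))"
  have finK: "finite K" by (simp add: K_def)
  define D where "D = Max (mdeg ` K)"
  have jK: "Poly_Mapping.keys (p j) \<subseteq> K" using j by (auto simp: K_def)
  moreover have "Poly_Mapping.keys (p j) \<noteq> {}" using False by (metis keys_eq_empty)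
  ultimately have K: "K \<noteq> {}" by blast
  have D: "mdeg m \<le> D" if "m \<in> K" for m using that finK by (simp add: D_def)
  \<comment> \<open>The order given by \<open>mkey\<close> need not respect the total degree, so the
    top degree over all summands is isolated first. Some summands may have coefficient zero at the
    chosen monomial, but not all.\<close>
  define S where "S = {m \<in> K. mdeg m = D}"
  have "D \<in> mdeg ` K" unfolding D_def using finK K by (intro Max_in) auto
  then have "S \<noteq> {}" by (auto simp: S_def)
  moreover have "finite S" using finK by (simp add: S_def)
  ultimately have fin: "finite (mkey ` S)" and ne: "mkey ` S \<noteq> {}" by auto
  obtain m where m: "m \<in> S" "Max (mkey ` S) = mkey m" using Max_in[OF fin ne] by auto
  have max: "mkey a \<le> mkey m" if "a \<in> S" for a
    unfolding m(2)[symmetric] using that fin by (intro Max_ge) auto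
  have sq: "Poly_Mapping.lookup (p i * p i) (m + m) = (Poly_Mapping.lookup (p i) m)\<^sup>2" if "i < n" for i
    unfolding power2_eq_square
  proof (rule lookup_mult_unique)
    fix a b assume ab: "a \<in> Poly_Mapping.keys (p i)" "b \<in> Poly_Mapping.keys (p i)" "a + b = m + m"
    then have K: "a \<in> K" "b \<in> K" using that by (auto simp: K_def)
    have "mdeg a + mdeg b = D + D" using arg_cong[OF ab(3), of mdeg] m(1) by (simp add: S_def mdeg_add)
    with D[OF K(1)] D[OF K(2)] have "mdeg a = D" "mdeg b = D" by auto
    with K have "a \<in> S" "b \<in> S" by (auto simp: S_def)
    then show "a = m \<and> b = m" using mkey_le_add_unique[of a m b m] max ab(3) by blast
  qed
  obtain i where i: "i < n" "m \<in> Poly_Mapping.keys (p i)" using m(1) by (auto simp: S_def K_def)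
  have "0 < (\<Sum>j<n. (Poly_Mapping.lookup (p j) m)\<^sup>2)"
    using i by (intro sum_pos2[of _ i]) (auto simp: in_keys_iff)
  then have "Poly_Mapping.lookup (\<Sum>j<n. p j * p j) (m + m) \<noteq> 0" by (simp add: lookup_sum sq)
  then have "m + m \<in> Poly_Mapping.keys (\<Sum>j<n. p j * p j)"
    by (simp only: in_keys_iff not_False_eq_True)
  then have "mdeg (m + m) \<le> tdeg (\<Sum>j<n. p j * p j)"
    by (rule tdeg_le_iff[THEN iffD1, OF order_refl, THEN bspec])
  moreover have "mdeg (m + m) = 2 * D" using m(1) by (simp add: S_def mdeg_add)
  moreover have "tdeg (p j) \<le> D" unfolding tdeg_le_iff using jK D by blast
  ultimately show ?thesis by simp
qed

subsection \<open>Sums of squares and quadratic modules\<close>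

lemma is_sos_iff: "is_sos s \<longleftrightarrow> (\<exists>(n::nat) p. s = (\<Sum>j<n. p j * p j))"
proof
  assume "is_sos s"
  then obtain ps where "s = sum_list (map (\<lambda>p. p * p) ps)" by (auto simp: is_sos_def)
  then have "s = (\<Sum>j<length ps. ps ! j * ps ! j)"
    by (simp add: sum_list_sum_nth atLeast0LessThan)
  then show "\<exists>(n::nat) p. s = (\<Sum>j<n. p j * p j)" by (intro exI)
next
  assume "\<exists>(n::nat) p. s = (\<Sum>j<n. p j * p j)"
  then obtain n :: nat and p where s: "s = (\<Sum>j<n. p j * p j)" by blast
  have "s = sum_list (map (\<lambda>p. p * p) (map p [0..<n]))"
    by (simp add: s sum_list_sum_nth atLeast0LessThan)
  then show "is_sos s" unfolding is_sos_def by (intro exI)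
qed

lemma is_sos_square: "is_sos (p * p)"
  unfolding is_sos_def by (intro exI[of _ "[p]"]) simp

lemma is_sos_0: "is_sos 0"
  unfolding is_sos_def by (intro exI[of _ "[]"]) simp

lemma is_sos_add: "is_sos p \<Longrightarrow> is_sos q \<Longrightarrow> is_sos (p + q)"
proof -
  assume "is_sos p" "is_sos q"
  then obtain ps qs where "p = sum_list (map (\<lambda>p. p * p) ps)" "q = sum_list (map (\<lambda>p. p * p) qs)"
    by (auto simp: is_sos_def)
  then have "p + q = sum_list (map (\<lambda>p. p * p) (ps @ qs))" by simp
  then show "is_sos (p + q)" unfolding is_sos_def by (rule exI)
qed

lemma is_sos_mult_square: "is_sos s \<Longrightarrow> is_sos (r * r * s)"
proof -
  assume "is_sos s"
  then obtain n :: nat and p where s: "s = (\<Sum>j<n. p j * p j)" by (auto simp: is_sos_iff)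
  then have "r * r * s = (\<Sum>j<n. (r * p j) * (r * p j))"
    by (simp add: sum_distrib_left mult_ac)
  then show "is_sos (r * r * s)" unfolding is_sos_iff by (intro exI)
qed

lemma is_sos_even_power: "is_sos (p ^ (2 * m))"
  using is_sos_square[of "p ^ m"] by (simp add: power_add[symmetric] mult_2)

lemma Qmod_t_mono: "t \<le> u \<Longrightarrow> Qmod_t t G \<subseteq> Qmod_t u G"
proof
  fix q assume tu: "t \<le> u" and "q \<in> Qmod_t t G"
  then obtain s0 s where s: "is_sos s0" "tdeg s0 \<le> t" "q = s0 + (\<Sum>i<length G. s i * G ! i)"
    "\<forall>i<length G. is_sos (s i) \<and> (s i = 0 \<or> tdeg (s i) + tdeg (G ! i) \<le> t)"
    unfolding Qmod_t_def by blast
  with tu have "tdeg s0 \<le> u" "\<forall>i<length G. is_sos (s i) \<and> (s i = 0 \<or> tdeg (s i) + tdeg (G ! i) \<le> u)"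
    by (auto intro: le_trans)
  with s show "q \<in> Qmod_t u G" unfolding Qmod_t_def by blast
qed

text \<open>Every representation fits into some truncation level, for instance the sum of all
  degrees involved, so the untruncated module can be handled without degree bounds.\<close>

lemma Qmod_iff:
  "q \<in> Qmod G \<longleftrightarrow> (\<exists>s0 s. is_sos s0 \<and> (\<forall>i<length G. is_sos (s i)) \<and> q = s0 + (\<Sum>i<length G. s i * G ! i))"
  (is "_ \<longleftrightarrow> ?R")
proof
  assume ?R
  then obtain s0 s where s: "is_sos s0" "\<forall>i<length G. is_sos (s i)" "q = s0 + (\<Sum>i<length G. s i * G ! i)"
    by blast
  define t where "t = tdeg s0 + (\<Sum>i<length G. tdeg (s i) + tdeg (G ! i))"
  have "tdeg (s i) + tdeg (G ! i) \<le> t" if "i < length G" for i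
  proof -
    have "tdeg (s i) + tdeg (G ! i) \<le> (\<Sum>i<length G. tdeg (s i) + tdeg (G ! i))"
      using that by (intro member_le_sum) auto
    then show ?thesis by (simp add: t_def)
  qed
  moreover have "tdeg s0 \<le> t" by (simp add: t_def)
  ultimately have "q \<in> Qmod_t t G"
    unfolding Qmod_t_def using s by (intro CollectI exI[of _ s0] exI[of _ s]) simp
  then show "q \<in> Qmod G" by (auto simp: Qmod_def)
qed (auto simp: Qmod_def Qmod_t_def)

lemma Qmod_sos: "is_sos s \<Longrightarrow> s \<in> Qmod G"
  unfolding Qmod_iff by (intro exI[of _ s] exI[of _ "\<lambda>_. 0"]) (simp add: is_sos_0)

lemma Qmod_add: "p \<in> Qmod G \<Longrightarrow> q \<in> Qmod G \<Longrightarrow> p + q \<in> Qmod G"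
proof -
  assume "p \<in> Qmod G" "q \<in> Qmod G"
  then obtain s0 s u0 u where "is_sos s0" "\<forall>i<length G. is_sos (s i)" "p = s0 + (\<Sum>i<length G. s i * G ! i)"
    "is_sos u0" "\<forall>i<length G. is_sos (u i)" "q = u0 + (\<Sum>i<length G. u i * G ! i)"
    unfolding Qmod_iff by blast
  then show "p + q \<in> Qmod G"
    unfolding Qmod_iff by (intro exI[of _ "s0 + u0"] exI[of _ "\<lambda>i. s i + u i"])
      (simp add: is_sos_add distrib_right sum.distrib)
qed

lemma Qmod_mult_square: "p \<in> Qmod G \<Longrightarrow> r * r * p \<in> Qmod G"
proof -
  assume "p \<in> Qmod G"
  then obtain s0 s where s: "is_sos s0" "\<forall>i<length G. is_sos (s i)" "p = s0 + (\<Sum>i<length G. s i * G ! i)"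
    unfolding Qmod_iff by blast
  have "r * r * p = r * r * s0 + (\<Sum>i<length G. r * r * s i * G ! i)"
    by (simp add: s(3) distrib_left sum_distrib_left mult_ac)
  with s show "r * r * p \<in> Qmod G"
    unfolding Qmod_iff by (intro exI[of _ "r * r * s0"] exI[of _ "\<lambda>i. r * r * s i"])
      (simp add: is_sos_mult_square)
qed

lemma Qmod_0: "0 \<in> Qmod G"
  by (rule Qmod_sos[OF is_sos_0])

lemma Qmod_sum: "(\<And>i. i \<in> A \<Longrightarrow> p i \<in> Qmod G) \<Longrightarrow> (\<Sum>i\<in>A. p i) \<in> Qmod G"
proof (induction A rule: infinite_finite_induct)
  case (insert x A)
  then show ?case by (simp add: Qmod_add)
qed (simp_all add: Qmod_0)

lemma Qmod_generator: "i < length G \<Longrightarrow> G ! i \<in> Qmod G"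
  unfolding Qmod_iff
proof (intro exI[of _ 0] exI[of _ "\<lambda>j. if j = i then 1 else 0"] conjI)
  assume i: "i < length G"
  show "\<forall>j<length G. is_sos (if j = i then 1 else 0 :: 'a rpoly)"
    using is_sos_square[of "1 :: 'a rpoly"] is_sos_0 by auto
  have "(\<Sum>j<length G. (if j = i then 1 else 0) * G ! j) = (\<Sum>j<length G. if j = i then G ! j else 0)"
    by (intro sum.cong) auto
  also have "\<dots> = G ! i" using i by simp
  finally show "G ! i = 0 + (\<Sum>j<length G. (if j = i then 1 else 0) * G ! j)" by simp
qed (rule is_sos_0)

subsection \<open>The support and its real radical\<close>

definition is_ideal :: "'a::comm_ring_1 set \<Rightarrow> bool" where
  "is_ideal I \<longleftrightarrow> 0 \<in> I \<and> (\<forall>a\<in>I. \<forall>b\<in>I. a + b \<in> I) \<and> (\<forall>r. \<forall>a\<in>I. r * a \<in> I)"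

lemma is_idealD:
  assumes "is_ideal I"
  shows "0 \<in> I" "a \<in> I \<Longrightarrow> b \<in> I \<Longrightarrow> a + b \<in> I" "a \<in> I \<Longrightarrow> r * a \<in> I" "a \<in> I \<Longrightarrow> a * r \<in> I"
    "a \<in> I \<Longrightarrow> - a \<in> I" "a \<in> I \<Longrightarrow> b \<in> I \<Longrightarrow> a - b \<in> I"
proof -
  show 0: "0 \<in> I" and add: "a \<in> I \<Longrightarrow> b \<in> I \<Longrightarrow> a + b \<in> I"
    and mult: "a \<in> I \<Longrightarrow> r * a \<in> I" for a b r
    using assms by (auto simp: is_ideal_def)
  show "a \<in> I \<Longrightarrow> a * r \<in> I" using mult[of a r] by (simp add: mult.commute)
  show minus: "a \<in> I \<Longrightarrow> - a \<in> I" for a using mult[of a "- 1"] by simp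
  show "a \<in> I \<Longrightarrow> b \<in> I \<Longrightarrow> a - b \<in> I" using add[of a "- b"] minus[of b] by simp
qed

lemma is_ideal_sum:
  assumes "is_ideal I"
  shows "(\<And>x. x \<in> A \<Longrightarrow> f x \<in> I) \<Longrightarrow> (\<Sum>x\<in>A. f x) \<in> I"
proof (induction A rule: infinite_finite_induct)
  case (insert x A)
  then show ?case by (simp add: is_idealD(2)[OF assms])
qed (simp_all add: is_idealD(1)[OF assms])

lemma is_ideal_power_mono:
  assumes "is_ideal I" "f ^ m \<in> I" "m \<le> n"
  shows "f ^ n \<in> I"
proof -
  have "f ^ n = f ^ (n - m) * f ^ m" using assms(3) by (simp add: power_add[symmetric])
  then show ?thesis using is_idealD(3)[OF assms(1,2)] by simp
qed

lemma is_ideal_radical: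
  assumes "is_ideal I"
  shows "is_ideal {f. \<exists>n. f ^ n \<in> I}"
  unfolding is_ideal_def
proof (intro conjI ballI allI)
  show "0 \<in> {f. \<exists>n. f ^ n \<in> I}"
    using is_idealD(1)[OF assms] by (auto intro: exI[of _ 1])
next
  fix a b assume "a \<in> {f. \<exists>n. f ^ n \<in> I}" "b \<in> {f. \<exists>n. f ^ n \<in> I}"
  then obtain m n where mn: "a ^ m \<in> I" "b ^ n \<in> I" by blast
  have "(a + b) ^ (m + n) = (\<Sum>k\<le>m + n. of_nat (m + n choose k) * a ^ k * b ^ (m + n - k))"
    by (rule binomial_ring)
  also have "\<dots> \<in> I"
  proof (rule is_ideal_sum[OF assms])
    fix k
    show "of_nat (m + n choose k) * a ^ k * b ^ (m + n - k) \<in> I"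
    proof (cases "m \<le> k")
      case True
      then show ?thesis
        by (intro is_idealD(3,4)[OF assms] is_ideal_power_mono[OF assms mn(1)])
    next
      case False
      then show ?thesis
        by (intro is_idealD(3)[OF assms] is_ideal_power_mono[OF assms mn(2)]) simp
    qed
  qed
  finally show "a + b \<in> {f. \<exists>n. f ^ n \<in> I}" by blast
next
  fix r a assume "a \<in> {f. \<exists>n. f ^ n \<in> I}"
  then show "r * a \<in> {f. \<exists>n. f ^ n \<in> I}"
    by (auto simp: power_mult_distrib intro: is_idealD(3)[OF assms])
qed

lemma mem_supp_set: "p \<in> supp_set Q \<longleftrightarrow> p \<in> Q \<and> - p \<in> Q"
  unfolding supp_set_def by (metis IntD1 IntD2 IntI add.inverse_inverse image_iff)

text \<open>Closure under arbitrary factors comes from writing \<open>r\<close> as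
  \<open>u * u - v * v\<close>, with \<open>u\<close> and \<open>v\<close> the halves of
  \<open>r + 1\<close> and \<open>r - 1\<close>: the module is stable under square factors, the
  support under signs.\<close>

lemma is_ideal_supp:
  fixes G :: "'n::finite rpoly list"
  shows "is_ideal (supp_set (Qmod G))"
  unfolding is_ideal_def
proof (intro conjI ballI allI)
  show "0 \<in> supp_set (Qmod G)" by (simp add: mem_supp_set Qmod_0)
next
  fix a b assume "a \<in> supp_set (Qmod G)" "b \<in> supp_set (Qmod G)"
  then show "a + b \<in> supp_set (Qmod G)"
    using Qmod_add[of a G b] Qmod_add[of "- a" G "- b"] by (simp add: mem_supp_set)
next
  fix r a assume a: "a \<in> supp_set (Qmod G)"
  define u :: "'n rpoly" where "u = cpoly (1/2) * (r + 1)"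
  define v :: "'n rpoly" where "v = cpoly (1/2) * (r - 1)"
  have uv: "u + v = r" "u - v = 1"
  proof -
    have "u + v = (cpoly (1/2) + cpoly (1/2)) * r" unfolding u_def v_def by (simp add: algebra_simps)
    then show "u + v = r" by (simp only: cpoly_half mult_1_left)
    have "u - v = cpoly (1/2) + cpoly (1/2)" unfolding u_def v_def by (simp add: algebra_simps)
    then show "u - v = 1" by (simp only: cpoly_half)
  qed
  have "r = (u + v) * (u - v)" by (simp only: uv mult_1_right)
  then have r: "r = u * u - v * v" by (simp add: algebra_simps)
  have "u * u * a + v * v * (- a) \<in> Qmod G" "u * u * (- a) + v * v * a \<in> Qmod G"
    using a by (auto simp: mem_supp_set simp del: mult_minus_right intro!: Qmod_add Qmod_mult_square)
  then show "r * a \<in> supp_set (Qmod G)"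
    by (simp add: mem_supp_set r algebra_simps)
qed

text \<open>The sum of squares \<open>s\<close> lies in the module, so adding it to the negative of
  \<open>f ^ (2 * m) + s\<close> leaves the negative of an even power. Real and ordinary radical of
  the support therefore agree.\<close>

lemma mem_real_radical_supp:
  "f \<in> real_radical (supp_set (Qmod G)) \<longleftrightarrow> (\<exists>n. f ^ n \<in> supp_set (Qmod G))"
proof
  assume "f \<in> real_radical (supp_set (Qmod G))"
  then obtain m s where ms: "is_sos s" "f ^ (2 * m) + s \<in> supp_set (Qmod G)"
    by (auto simp: real_radical_def)
  have "- (f ^ (2 * m) + s) \<in> Qmod G" using ms(2) unfolding mem_supp_set by (rule conjunct2)
  then have "- (f ^ (2 * m) + s) + s \<in> Qmod G" by (rule Qmod_add[OF _ Qmod_sos[OF ms(1)]])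
  then have "f ^ (2 * m) \<in> supp_set (Qmod G)"
    by (simp add: mem_supp_set Qmod_sos is_sos_even_power)
  then show "\<exists>n. f ^ n \<in> supp_set (Qmod G)" ..
next
  assume "\<exists>n. f ^ n \<in> supp_set (Qmod G)"
  then obtain n where "f ^ n \<in> supp_set (Qmod G)" ..
  then have "f ^ (2 * n) + 0 \<in> supp_set (Qmod G)"
    using is_ideal_power_mono[OF is_ideal_supp, of f n G "2 * n"] by simp
  then show "f \<in> real_radical (supp_set (Qmod G))"
    unfolding real_radical_def using is_sos_0 by (intro CollectI exI[of _ n] exI[of _ 0] conjI)
qed

lemma is_ideal_real_radical: "is_ideal (real_radical (supp_set (Qmod G)))"
proof -
  have "real_radical (supp_set (Qmod G)) = {f. \<exists>n. f ^ n \<in> supp_set (Qmod G)}"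
    using mem_real_radical_supp by blast
  then show ?thesis using is_ideal_radical[OF is_ideal_supp] by simp
qed

lemma real_radical_square_cancel:
  assumes "f * f \<in> real_radical (supp_set (Qmod G))"
  shows "f \<in> real_radical (supp_set (Qmod G))"
proof -
  obtain n where "(f * f) ^ n \<in> supp_set (Qmod G)"
    using assms unfolding mem_real_radical_supp by blast
  then have "f ^ (2 * n) \<in> supp_set (Qmod G)" by (simp add: power_mult power2_eq_square)
  then show ?thesis unfolding mem_real_radical_supp by blast
qed

text \<open>Newton iteration for \<open>(1 - h/a)\<^sup>-\<^sup>1\<^sup>/\<^sup>2\<close>, with denominators cleared: \<open>a - h\<close> times a square is an odd
  power of \<open>a\<close> up to any prescribed order in \<open>h\<close>.\<close>

lemma inverse_sqrt_approximation:
  fixes a h c :: "'a::comm_ring_1"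
  assumes c: "c + c = 1"
  shows "\<exists>Z N R. (a - h) * (Z * Z) = a ^ (2 * N + 1) + h ^ (2 ^ e) * R"
proof (induction e)
  case 0
  show ?case by (intro exI[of _ 1] exI[of _ 0] exI[of _ "- 1"]) simp
next
  case (Suc e)
  then obtain Z N R where IH: "(a - h) * (Z * Z) = a ^ (2 * N + 1) + h ^ (2 ^ e) * R" by blast
  define A where "A = a ^ (2 * N + 1)"
  define E where "E = h ^ (2 ^ e) * R"
  \<comment> \<open>One Newton step. As \<open>c\<close> acts as one half, the terms linear in the
    error \<open>E\<close> cancel, leaving \<open>A * A * A\<close> and a multiple of
    \<open>E * E\<close>; clearing denominators triples the exponent of \<open>a\<close>.\<close>
  define Z' where "Z' = Z * (A - c * E)"
  have A3: "A * A * A = a ^ (2 * (3 * N + 1) + 1)"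
    unfolding A_def power_add[symmetric] by (rule arg_cong[of _ _ "\<lambda>n. a ^ n"]) simp
  have E2: "E * E = h ^ (2 ^ Suc e) * (R * R)"
    unfolding E_def by (simp add: mult_2 power_add mult_ac)
  have "(a - h) * (Z' * Z') = ((a - h) * (Z * Z)) * ((A - c * E) * (A - c * E))"
    unfolding Z'_def by (simp only: mult_ac)
  also have "\<dots> = (A + E) * (A * A - (c + c) * (A * E) + c * c * (E * E))"
    unfolding IH A_def[symmetric] E_def[symmetric] by (simp add: algebra_simps)
  also have "\<dots> = A * A * A + (E * E) * (c * c * A - A + c * c * E)"
    unfolding c by (simp add: algebra_simps)
  also have "\<dots> = a ^ (2 * (3 * N + 1) + 1) + h ^ (2 ^ Suc e) * ((R * R) * (c * c * A - A + c * c * E))"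
    unfolding A3 E2 by (simp only: mult.assoc)
  finally show ?case by (intro exI)
qed

text \<open>Modulo the support, \<open>h = a + b\<close> is nilpotent; hence \<open>- b = a - h\<close> times a square is an odd power
  of \<open>a\<close>, which therefore lies both in the quadratic module and in its negative.\<close>

lemma real_radical_convex:
  assumes a: "a \<in> Qmod G" and b: "b \<in> Qmod G" and ab: "a + b \<in> real_radical (supp_set (Qmod G))"
  shows "a \<in> real_radical (supp_set (Qmod G))"
proof -
  define h where "h = a + b"
  obtain n where "h ^ n \<in> supp_set (Qmod G)" using ab unfolding mem_real_radical_supp h_def by blast
  then have hn: "h ^ (2 ^ n) \<in> supp_set (Qmod G)"
    by (rule is_ideal_power_mono[OF is_ideal_supp]) (simp add: less_imp_le)
  obtain Z N R where Z: "(a - h) * (Z * Z) = a ^ (2 * N + 1) + h ^ (2 ^ n) * R"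
    using inverse_sqrt_approximation[OF cpoly_half] by blast
  have "Z * Z * b = - ((a - h) * (Z * Z))" by (simp add: h_def algebra_simps)
  then have eq: "- (a ^ (2 * N + 1)) = Z * Z * b + h ^ (2 ^ n) * R"
    unfolding Z by (simp only: minus_add_distrib minus_add_cancel add.assoc add.left_inverse add_0_right)
  have "h ^ (2 ^ n) * R \<in> Qmod G"
    using is_idealD(4)[OF is_ideal_supp hn] by (simp add: mem_supp_set)
  then have "- (a ^ (2 * N + 1)) \<in> Qmod G"
    unfolding eq by (intro Qmod_add Qmod_mult_square b)
  moreover have "a ^ (2 * N + 1) = a ^ N * a ^ N * a" by (simp only: power_add power_one_right power_even_eq power2_eq_square)
  then have "a ^ (2 * N + 1) \<in> Qmod G" using Qmod_mult_square[OF a] by simp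
  ultimately have "a ^ (2 * N + 1) \<in> supp_set (Qmod G)" unfolding mem_supp_set by simp
  then show ?thesis unfolding mem_real_radical_supp by blast
qed

lemma real_radical_convex_sum:
  assumes "finite A" "\<And>x. x \<in> A \<Longrightarrow> q x \<in> Qmod G" "(\<Sum>x\<in>A. q x) \<in> real_radical (supp_set (Qmod G))"
    and "x \<in> A"
  shows "q x \<in> real_radical (supp_set (Qmod G))"
proof (rule real_radical_convex)
  show "q x \<in> Qmod G" "(\<Sum>y\<in>A - {x}. q y) \<in> Qmod G" using assms by (auto intro: Qmod_sum)
  show "q x + (\<Sum>y\<in>A - {x}. q y) \<in> real_radical (supp_set (Qmod G))"
    using assms by (simp add: sum.remove[symmetric])
qed

subsection \<open>Hilbert's basis theorem\<close>

lemma nat_incseq_subseq: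
  fixes s :: "nat \<Rightarrow> nat"
  shows "\<exists>r. strict_mono r \<and> incseq (s \<circ> r)"
proof -
  obtain r where r: "strict_mono r" "monoseq (\<lambda>n. s (r n))" using seq_monosub by blast
  show ?thesis
  proof (cases "incseq (\<lambda>n. s (r n))")
    case True
    then show ?thesis using r(1) by (auto simp: comp_def)
  next
    case False
    then have dec: "decseq (\<lambda>n. s (r n))" using r(2) by (auto simp: monoseq_iff)
    \<comment> \<open>The least value is attained, and a decreasing sequence is constant from there
      on, so its tail is weakly increasing.\<close>
    define c where "c = (LEAST c. c \<in> range (\<lambda>n. s (r n)))"
    have "c \<in> range (\<lambda>n. s (r n))" unfolding c_def by (rule LeastI[of _ "s (r 0)"]) simp
    then obtain N where N: "s (r N) = c" by auto
    have "s (r (n + N)) = c" for n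
    proof (rule antisym)
      show "s (r (n + N)) \<le> c" using decseqD[OF dec, of N "n + N"] N by simp
      show "c \<le> s (r (n + N))" unfolding c_def by (rule Least_le) simp
    qed
    then have "incseq (s \<circ> (\<lambda>n. r (n + N)))" by (simp add: incseq_def)
    moreover have "strict_mono (\<lambda>n. r (n + N))" using r(1) by (simp add: strict_mono_def)
    ultimately show ?thesis by blast
  qed
qed

text \<open>A further subsequence keeps the coordinates already treated monotone, so they are
  handled one after the other.\<close>

lemma incseq_subseq_finite:
  fixes f :: "nat \<Rightarrow> 'a \<Rightarrow> nat"
  assumes "finite S"
  shows "\<exists>r. strict_mono r \<and> (\<forall>x\<in>S. incseq (\<lambda>n. f (r n) x))"
  using assms
proof (induction S rule: finite_induct)
  case empty
  show ?case by (intro exI[of _ id]) (simp add: strict_mono_def)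
next
  case (insert y S)
  then obtain r where r: "strict_mono r" "\<And>x. x \<in> S \<Longrightarrow> incseq (\<lambda>n. f (r n) x)" by blast
  obtain u where u: "strict_mono u" "incseq ((\<lambda>n. f (r n) y) \<circ> u)"
    using nat_incseq_subseq by blast
  have "incseq (\<lambda>n. f (r (u n)) x)" if "x \<in> S" for x
    using r(2)[OF that] u(1) by (simp add: incseq_def strict_mono_less_eq)
  moreover have "strict_mono (\<lambda>n. r (u n))" using r(1) u(1) by (simp add: strict_mono_def)
  ultimately show ?case using u(2) by (intro exI[of _ "\<lambda>n. r (u n)"]) (auto simp: comp_def)
qed

text \<open>\<open>M\<close> consists of the elements of \<open>S\<close> minimal for divisibility.
  Infinitely many would include two distinct comparable ones, by a subsequence increasing in every
  coordinate; descent on \<open>mdeg\<close> finds a minimal element below any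
  \<open>s\<close>.\<close>

lemma dickson_finite_basis:
  fixes S :: "('n::finite \<Rightarrow>\<^sub>0 nat) set"
  shows "\<exists>M. finite M \<and> M \<subseteq> S \<and> (\<forall>s\<in>S. \<exists>m\<in>M. \<exists>c. s = m + c)"
proof -
  define M where "M = {m \<in> S. \<forall>a\<in>S. \<forall>c. m = a + c \<longrightarrow> a = m}"
  have "finite M"
  proof (rule ccontr)
    assume "infinite M"
    then obtain f :: "nat \<Rightarrow> 'n \<Rightarrow>\<^sub>0 nat" where f: "inj f" "range f \<subseteq> M"
      using infinite_countable_subset by blast
    obtain r where r: "strict_mono r" "\<And>x. incseq (\<lambda>n. Poly_Mapping.lookup (f (r n)) x)"
      using incseq_subseq_finite[of "UNIV :: 'n set" "\<lambda>n. Poly_Mapping.lookup (f n)"] by auto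
    \<comment> \<open>Subtraction of exponents truncates at zero; monotonicity makes it exact
      here.\<close>
    have "f (r 1) = f (r 0) + (f (r 1) - f (r 0))"
      by (rule poly_mapping_eqI) (use incseqD[OF r(2), of 0 1] in \<open>simp add: lookup_add lookup_minus\<close>)
    moreover have "f (r 0) \<in> S" "f (r 1) \<in> M" using f(2) by (auto simp: M_def)
    ultimately have "f (r 0) = f (r 1)" unfolding M_def by blast
    then have "r 0 = r 1" using f(1) by (simp add: inj_eq)
    then show False using r(1) by (simp add: strict_mono_eq)
  qed
  moreover have "\<exists>m\<in>M. \<exists>c. s = m + c" if "s \<in> S" for s
    using that
  proof (induction "mdeg s" arbitrary: s rule: less_induct)
    case less
    show ?case
    proof (cases "s \<in> M")
      case True
      then show ?thesis by (intro bexI[of _ s] exI[of _ 0]) simp_all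
    next
      case False
      then obtain a c where a: "a \<in> S" "s = a + c" "a \<noteq> s" using less.prems by (auto simp: M_def)
      have "mdeg c \<noteq> 0"
      proof
        assume "mdeg c = 0"
        then have "c = 0" by (intro poly_mapping_eqI) (simp add: mdeg_def)
        then show False using a by simp
      qed
      then have "mdeg a < mdeg s" using a(2) by (simp add: mdeg_add)
      then obtain m e where "m \<in> M" "a = m + e" using less.hyps a(1) by blast
      then show ?thesis using a(2) by (intro bexI[of _ m] exI[of _ "e + c"]) (simp_all add: add.assoc)
    qed
  qed
  moreover have "M \<subseteq> S" by (auto simp: M_def)
  ultimately show ?thesis by blast
qed

section \<open>Generated ideals\<close>

lemma ideal_gen_subset:
  assumes "is_ideal J" "S \<subseteq> J"
  shows "ideal_gen S \<subseteq> J"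
proof
  fix f assume "f \<in> ideal_gen S"
  then obtain F c where "F \<subseteq> S" "f = (\<Sum>p\<in>F. c p * p)" by (auto simp: ideal_gen_def)
  then show "f \<in> J"
    using assms(2) by (auto intro!: is_ideal_sum[OF assms(1)] is_idealD(3)[OF assms(1)])
qed

lemma ideal_gen_superset: "S \<subseteq> ideal_gen S"
proof
  fix f assume "f \<in> S"
  then show "f \<in> ideal_gen S"
    unfolding ideal_gen_def by (intro CollectI exI[of _ "{f}"] exI[of _ "\<lambda>_. 1"]) simp
qed

lemma is_ideal_ideal_gen: "is_ideal (ideal_gen S)"
  unfolding is_ideal_def
proof (intro conjI ballI allI)
  show "0 \<in> ideal_gen S"
    unfolding ideal_gen_def by (intro CollectI exI[of _ "{}"]) simp
next
  fix a b assume "a \<in> ideal_gen S" "b \<in> ideal_gen S"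
  then obtain F c H d where F: "finite F" "F \<subseteq> S" "a = (\<Sum>p\<in>F. c p * p)"
    and H: "finite H" "H \<subseteq> S" "b = (\<Sum>p\<in>H. d p * p)"
    by (auto simp: ideal_gen_def)
  define e where "e p = (if p \<in> F then c p else 0) + (if p \<in> H then d p else 0)" for p
  have "a = (\<Sum>p\<in>F \<union> H. (if p \<in> F then c p else 0) * p)"
    unfolding F(3) using F(1) H(1) by (intro sum.mono_neutral_cong_left) auto
  moreover have "b = (\<Sum>p\<in>F \<union> H. (if p \<in> H then d p else 0) * p)"
    unfolding H(3) using F(1) H(1) by (intro sum.mono_neutral_cong_left) auto
  ultimately have "a + b = (\<Sum>p\<in>F \<union> H. e p * p)"
    by (simp only: e_def distrib_right sum.distrib)
  then show "a + b \<in> ideal_gen S"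
    unfolding ideal_gen_def using F H by (intro CollectI exI[of _ "F \<union> H"] exI[of _ e]) simp
next
  fix r a assume "a \<in> ideal_gen S"
  then obtain F c where F: "finite F" "F \<subseteq> S" "a = (\<Sum>p\<in>F. c p * p)" by (auto simp: ideal_gen_def)
  then have "r * a = (\<Sum>p\<in>F. (r * c p) * p)" by (simp add: sum_distrib_left mult.assoc)
  then show "r * a \<in> ideal_gen S"
    unfolding ideal_gen_def using F by (intro CollectI exI[of _ F] exI[of _ "\<lambda>p. r * c p"]) simp
qed

section \<open>Leading monomials and reduction\<close>

definition is_lead :: "('n::finite \<Rightarrow>\<^sub>0 nat) \<Rightarrow> 'n rpoly \<Rightarrow> bool" where
  "is_lead m p \<longleftrightarrow> m \<in> Poly_Mapping.keys p \<and> (\<forall>a\<in>Poly_Mapping.keys p. mkey a \<le> mkey m)"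

lemma ex_lead: "p \<noteq> 0 \<Longrightarrow> \<exists>m. is_lead m p"
proof -
  assume "p \<noteq> 0"
  then have "mkey ` Poly_Mapping.keys p \<noteq> {}" by simp
  then have "Max (mkey ` Poly_Mapping.keys p) \<in> mkey ` Poly_Mapping.keys p" by (intro Max_in) auto
  then obtain m where m: "m \<in> Poly_Mapping.keys p" "Max (mkey ` Poly_Mapping.keys p) = mkey m" by auto
  then have "mkey a \<le> mkey m" if "a \<in> Poly_Mapping.keys p" for a
    unfolding m(2)[symmetric] using that by (intro Max_ge) auto
  then show ?thesis using m(1) by (auto simp: is_lead_def)
qed

text \<open>\<open>F\<close> has an element of \<open>J\<close> for each of the finitely many
  leading monomials selected by Dickson's lemma. Subtracting a monomial multiple of one of them
  cancels the leading term of \<open>p\<close>, and this terminates because \<open>mkey\<close>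
  takes natural values.\<close>

lemma hilbert_basis:
  fixes J :: "'n::finite rpoly set"
  assumes J: "is_ideal J"
  shows "\<exists>F. finite F \<and> F \<subseteq> J \<and> ideal_gen F = J"
proof -
  define S where "S = {m. \<exists>p\<in>J. is_lead m p}"
  obtain M where M: "finite M" "M \<subseteq> S" "\<And>s. s \<in> S \<Longrightarrow> \<exists>m\<in>M. \<exists>c. s = m + c"
    using dickson_finite_basis[of S] by blast
  have "\<forall>m\<in>M. \<exists>p. p \<in> J \<and> is_lead m p" using M(2) by (auto simp: S_def)
  then obtain b where b: "\<And>m. m \<in> M \<Longrightarrow> b m \<in> J" "\<And>m. m \<in> M \<Longrightarrow> is_lead m (b m)" by metis
  define F where "F = b ` M"
  have FJ: "F \<subseteq> J" using b(1) by (auto simp: F_def)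
  have gen: "p \<in> ideal_gen F" if "p \<in> J" "is_lead m p" for p m
    using that
  proof (induction "mkey m" arbitrary: p m rule: less_induct)
    case less
    have "m \<in> S" using less.prems by (auto simp: S_def)
    then obtain a c where a: "a \<in> M" "m = a + c" using M(3) by blast
    have ba: "is_lead a (b a)" using b(2)[OF a(1)] .
    define d where "d = Poly_Mapping.lookup p m / Poly_Mapping.lookup (b a) a"
    define h where "h = Poly_Mapping.single c d * b a"
    have hF: "h \<in> ideal_gen F"
      unfolding h_def using a(1) ideal_gen_superset[of F]
      by (intro is_idealD(3)[OF is_ideal_ideal_gen]) (auto simp: F_def)
    define q where "q = p - h"
    have "Poly_Mapping.lookup h (c + a) = Poly_Mapping.lookup (Poly_Mapping.single c d) c * Poly_Mapping.lookup (b a) a"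
      unfolding h_def by (rule lookup_mult_unique) (auto split: if_splits)
    then have "Poly_Mapping.lookup h m = Poly_Mapping.lookup p m"
      using ba a(2) by (simp add: d_def is_lead_def in_keys_iff add.commute)
    then have qm: "m \<notin> Poly_Mapping.keys q" by (simp add: q_def in_keys_iff lookup_minus)
    have hk: "mkey k \<le> mkey m" if k: "k \<in> Poly_Mapping.keys h" for k
    proof -
      obtain x l where "k = x + l" "x \<in> Poly_Mapping.keys (Poly_Mapping.single c d)" "l \<in> Poly_Mapping.keys (b a)"
        using k keys_mult[of "Poly_Mapping.single c d" "b a"] unfolding h_def by blast
      moreover from this have "x = c" by (simp split: if_splits)
      ultimately show ?thesis using ba a(2) by (simp add: is_lead_def mkey_add)
    qed
    have qk: "mkey k < mkey m" if k: "k \<in> Poly_Mapping.keys q" for k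
    proof -
      have "k \<in> Poly_Mapping.keys p \<or> k \<in> Poly_Mapping.keys h"
        using k by (auto simp: q_def in_keys_iff lookup_minus)
      then have "mkey k \<le> mkey m" using hk less.prems(2) by (auto simp: is_lead_def)
      moreover have "mkey k \<noteq> mkey m" using qm k inj_eq[OF mkey_inj] by metis
      ultimately show ?thesis by simp
    qed
    have qJ: "q \<in> J"
      unfolding q_def h_def by (intro is_idealD(3,6)[OF J] less.prems(1) b(1) a(1))
    have "q \<in> ideal_gen F"
    proof (cases "q = 0")
      case True
      then show ?thesis using is_idealD(1)[OF is_ideal_ideal_gen] by simp
    next
      case False
      then obtain k where "is_lead k q" using ex_lead by blast
      moreover from this have "mkey k < mkey m" using qk by (simp add: is_lead_def)
      ultimately show ?thesis using less.hyps qJ by blast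
    qed
    then have "q + h \<in> ideal_gen F" using hF by (rule is_idealD(2)[OF is_ideal_ideal_gen])
    then show ?case by (simp add: q_def)
  qed
  have "p \<in> ideal_gen F" if "p \<in> J" for p
    using gen[OF that] ex_lead[of p] is_idealD(1)[OF is_ideal_ideal_gen] by metis
  then have "ideal_gen F = J" using ideal_gen_subset[OF J FJ] by blast
  moreover have "finite F" using M(1) by (simp add: F_def)
  ultimately show ?thesis using FJ by blast
qed

subsection \<open>Standard monomials\<close>

lemma keys_diff_subset: "Poly_Mapping.keys (p - q) \<subseteq> Poly_Mapping.keys p \<union> Poly_Mapping.keys (q :: 'n::finite rpoly)"
  by (auto simp: in_keys_iff lookup_minus)

text \<open>Greedy choice, one monomial at a time: \<open>m\<close> is discarded when a nonzero
  element of \<open>N\<close> supported on \<open>insert m A\<close> can eliminate it, and kept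
  otherwise. Thus \<open>A\<close> is a monomial basis of the polynomials on \<open>D\<close> modulo
  \<open>N\<close>.\<close>

lemma ex_standard_monomials:
  fixes N :: "'n::finite rpoly set"
  assumes D: "finite D"
    and zero: "0 \<in> N" and add: "\<And>p q. p \<in> N \<Longrightarrow> q \<in> N \<Longrightarrow> p + q \<in> N"
    and scale: "\<And>c p. p \<in> N \<Longrightarrow> cpoly c * p \<in> N"
  shows "\<exists>A\<subseteq>D. (\<forall>p\<in>N. Poly_Mapping.keys p \<subseteq> A \<longrightarrow> p = 0) \<and>
    (\<forall>p. Poly_Mapping.keys p \<subseteq> D \<longrightarrow> (\<exists>w. Poly_Mapping.keys w \<subseteq> A \<and> p - w \<in> N))"
  using D
proof (induction D rule: finite_induct)
  case empty
  show ?case using zero by (auto intro!: exI[of _ 0])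
next
  case (insert m D)
  then obtain A where A: "A \<subseteq> D" "\<And>p. p \<in> N \<Longrightarrow> Poly_Mapping.keys p \<subseteq> A \<Longrightarrow> p = 0"
    "\<And>p. Poly_Mapping.keys p \<subseteq> D \<Longrightarrow> \<exists>w. Poly_Mapping.keys w \<subseteq> A \<and> p - w \<in> N" by blast
  show ?case
  proof (cases "\<exists>p\<in>N. Poly_Mapping.keys p \<subseteq> insert m A \<and> p \<noteq> 0")
    case True
    then obtain p where p: "p \<in> N" "Poly_Mapping.keys p \<subseteq> insert m A" "p \<noteq> 0" by blast
    then have "m \<in> Poly_Mapping.keys p" using A(2) by blast
    then have pm: "Poly_Mapping.lookup p m \<noteq> 0" by (simp add: in_keys_iff)
    have "\<exists>w. Poly_Mapping.keys w \<subseteq> A \<and> q - w \<in> N" if q: "Poly_Mapping.keys q \<subseteq> insert m D" for q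
    proof -
      define e where "e = cpoly (Poly_Mapping.lookup q m / Poly_Mapping.lookup p m) * p"
      have "m \<notin> Poly_Mapping.keys (q - e)" using pm by (simp add: e_def in_keys_iff lookup_minus)
      moreover have "Poly_Mapping.keys (q - e) \<subseteq> Poly_Mapping.keys q \<union> Poly_Mapping.keys p"
        by (auto simp: e_def in_keys_iff lookup_minus)
      ultimately have "Poly_Mapping.keys (q - e) \<subseteq> D"
        using q p(2) A(1) by blast
      then obtain w where w: "Poly_Mapping.keys w \<subseteq> A" "q - e - w \<in> N" using A(3) by blast
      have "(q - e - w) + e \<in> N" using w(2) scale[OF p(1)] by (auto simp only: e_def intro: add)
      then show ?thesis using w(1) by auto
    qed
    then show ?thesis using A(1,2) by (intro exI[of _ A]) auto
  next
    case False
    have "\<exists>w. Poly_Mapping.keys w \<subseteq> insert m A \<and> q - w \<in> N" if q: "Poly_Mapping.keys q \<subseteq> insert m D" for q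
    proof -
      define e where "e = Poly_Mapping.single m (Poly_Mapping.lookup q m)"
      have "Poly_Mapping.keys (q - e) \<subseteq> D"
        using q by (auto simp: e_def in_keys_iff lookup_minus lookup_single when_def split: if_splits)
      then obtain w where w: "Poly_Mapping.keys w \<subseteq> A" "q - e - w \<in> N" using A(3) by blast
      have "Poly_Mapping.keys (w + e) \<subseteq> insert m A"
        using w(1) keys_add[of w e] by (auto simp: e_def split: if_splits)
      moreover have "q - (w + e) \<in> N" using w(2) by (simp add: algebra_simps)
      ultimately show ?thesis by blast
    qed
    then show ?thesis using A(1) False by (intro exI[of _ "insert m A"]) auto
  qed
qed

section \<open>Functionals on polynomials of bounded degree\<close>

lemma dual_t_sum:
  assumes "\<sigma> \<in> dual_t t" "\<And>x. x \<in> X \<Longrightarrow> tdeg (p x) \<le> t"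
  shows "\<sigma> (\<Sum>x\<in>X. p x) = (\<Sum>x\<in>X. \<sigma> (p x))"
proof -
  have "\<sigma> (cpoly 0 * 0) = 0 * \<sigma> 0" using assms(1) unfolding dual_t_def polys_le_def by fastforce
  then have 0: "\<sigma> 0 = 0" by simp
  show ?thesis using assms(2)
  proof (induction X rule: infinite_finite_induct)
    case (insert x X)
    then have "tdeg (p x) \<le> t" "tdeg (\<Sum>x\<in>X. p x) \<le> t" by (auto intro: tdeg_sum_le)
    then have "\<sigma> (p x + (\<Sum>x\<in>X. p x)) = \<sigma> (p x) + \<sigma> (\<Sum>x\<in>X. p x)"
      using assms(1) by (simp add: dual_t_def polys_le_def)
    then show ?case using insert by simp
  qed (simp_all add: 0)
qed

lemma dual_t_add: "\<sigma> \<in> dual_t t \<Longrightarrow> tdeg p \<le> t \<Longrightarrow> tdeg q \<le> t \<Longrightarrow> \<sigma> (p + q) = \<sigma> p + \<sigma> q"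
  by (simp add: dual_t_def polys_le_def)

lemma dual_t_scale: "\<sigma> \<in> dual_t t \<Longrightarrow> tdeg p \<le> t \<Longrightarrow> \<sigma> (cpoly c * p) = c * \<sigma> p"
  by (simp add: dual_t_def polys_le_def)

lemma dual_t_uminus: "\<sigma> \<in> dual_t t \<Longrightarrow> tdeg p \<le> t \<Longrightarrow> \<sigma> (- p) = - \<sigma> p"
  using dual_t_scale[of \<sigma> t p "- 1"] by (simp add: cpoly_minus_one_mult)

text \<open>\<open>\<phi> b\<close> reads off the coefficient at \<open>b\<close> of the normal
  form, the representative modulo \<open>J\<close> supported on the standard monomials
  \<open>B\<close>. This supplies the finite set of coordinates for
  \<open>strictly_positive_functional\<close>.\<close>

lemma ex_quotient_coordinates:
  fixes J :: "'n::finite rpoly set"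
  assumes J: "is_ideal J"
  shows "\<exists>(B :: ('n \<Rightarrow>\<^sub>0 nat) set) \<phi>. finite B \<and> (\<forall>b. \<phi> b \<in> dual_t t) \<and>
    (\<forall>p. tdeg p \<le> t \<longrightarrow> (p \<in> J \<longleftrightarrow> (\<forall>b\<in>B. \<phi> b p = 0)))"
proof -
  define D :: "('n \<Rightarrow>\<^sub>0 nat) set" where "D = {m. mdeg m \<le> t}"
  obtain B where B: "B \<subseteq> D" "\<And>p. p \<in> J \<Longrightarrow> Poly_Mapping.keys p \<subseteq> B \<Longrightarrow> p = 0"
    "\<And>p. Poly_Mapping.keys p \<subseteq> D \<Longrightarrow> \<exists>w. Poly_Mapping.keys w \<subseteq> B \<and> p - w \<in> J"
    using ex_standard_monomials[of D J] is_idealD(1,2,3)[OF J] by (auto simp: D_def finite_mdeg_le)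
  have finB: "finite B" using B(1) by (rule finite_subset) (simp add: D_def finite_mdeg_le)
  have D_iff: "Poly_Mapping.keys p \<subseteq> D \<longleftrightarrow> tdeg p \<le> t" for p :: "'n rpoly"
    by (auto simp: D_def tdeg_le_iff)
  have "\<forall>p. \<exists>w. tdeg p \<le> t \<longrightarrow> Poly_Mapping.keys w \<subseteq> B \<and> p - w \<in> J"
    using B(3) D_iff by blast
  then obtain nf where nf: "\<And>p. tdeg p \<le> t \<Longrightarrow> Poly_Mapping.keys (nf p) \<subseteq> B"
    "\<And>p. tdeg p \<le> t \<Longrightarrow> p - nf p \<in> J" by metis
  \<comment> \<open>Uniqueness of the representative is what makes \<open>nf\<close> linear.\<close>
  have uniq: "nf p = w" if "tdeg p \<le> t" "Poly_Mapping.keys w \<subseteq> B" "p - w \<in> J" for p w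
  proof -
    have "(p - w) - (p - nf p) \<in> J" by (intro is_idealD(6)[OF J that(3)] nf(2) that(1))
    then have "nf p - w \<in> J" by simp
    moreover have "Poly_Mapping.keys (nf p - w) \<subseteq> B"
      using keys_diff_subset[of "nf p" w] that(2) nf(1)[OF that(1)] by blast
    ultimately show ?thesis using B(2) by (metis eq_iff_diff_eq_0)
  qed
  have nf_add: "nf (p + q) = nf p + nf q" if "tdeg p \<le> t" "tdeg q \<le> t" for p q
  proof (rule uniq)
    show "tdeg (p + q) \<le> t" using that by (rule tdeg_add_le)
    show "Poly_Mapping.keys (nf p + nf q) \<subseteq> B" using keys_add[of "nf p" "nf q"] nf(1) that by blast
    have "(p - nf p) + (q - nf q) \<in> J" by (rule is_idealD(2)[OF J nf(2)[OF that(1)] nf(2)[OF that(2)]])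
    then show "p + q - (nf p + nf q) \<in> J" by (simp add: algebra_simps)
  qed
  have nf_scale: "nf (cpoly c * p) = cpoly c * nf p" if "tdeg p \<le> t" for c p
  proof (rule uniq)
    show "tdeg (cpoly c * p) \<le> t" using tdeg_cpoly_mult_le that by (rule order_trans)
    show "Poly_Mapping.keys (cpoly c * nf p) \<subseteq> B" using nf(1)[OF that] by (auto simp: in_keys_iff)
    have "cpoly c * (p - nf p) \<in> J" by (rule is_idealD(3)[OF J nf(2)[OF that]])
    then show "cpoly c * p - cpoly c * nf p \<in> J" by (simp add: right_diff_distrib)
  qed
  define \<phi> where "\<phi> b p = (if tdeg p \<le> t then Poly_Mapping.lookup (nf p) b else 0)" for b p
  have "\<phi> b \<in> dual_t t" for b
    unfolding dual_t_def
  proof (intro CollectI conjI ballI allI impI)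
    fix p q :: "'n rpoly" assume "p \<in> polys_le t" "q \<in> polys_le t"
    then show "\<phi> b (p + q) = \<phi> b p + \<phi> b q"
      by (simp add: \<phi>_def polys_le_def tdeg_add_le nf_add lookup_add)
  next
    fix c and p :: "'n rpoly" assume "p \<in> polys_le t"
    then show "\<phi> b (cpoly c * p) = c * \<phi> b p"
      using order_trans[OF tdeg_cpoly_mult_le[of c p], of t] by (simp add: \<phi>_def polys_le_def nf_scale)
  next
    fix p :: "'n rpoly" assume "p \<notin> polys_le t"
    then show "\<phi> b p = 0" by (simp add: \<phi>_def polys_le_def)
  qed
  moreover have "p \<in> J \<longleftrightarrow> (\<forall>b\<in>B. \<phi> b p = 0)" if p: "tdeg p \<le> t" for p
  proof
    assume "p \<in> J"
    then have "nf p = 0" using p by (intro uniq) auto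
    then show "\<forall>b\<in>B. \<phi> b p = 0" using p by (simp add: \<phi>_def)
  next
    assume "\<forall>b\<in>B. \<phi> b p = 0"
    then have "nf p = 0"
      using nf(1)[OF p] p by (intro poly_mapping_eqI) (auto simp: \<phi>_def in_keys_iff)
    then show "p \<in> J" using nf(2)[OF p] by simp
  qed
  ultimately show ?thesis using finB by blast
qed

subsection \<open>Positive functionals\<close>

lemma ex_key_tdeg: "p \<noteq> 0 \<Longrightarrow> \<exists>m\<in>Poly_Mapping.keys p. mdeg m = tdeg p"
proof -
  assume p: "p \<noteq> 0"
  then have "Max (mdeg ` Poly_Mapping.keys p) \<in> mdeg ` Poly_Mapping.keys p" by (intro Max_in) auto
  then obtain m where "Max (mdeg ` Poly_Mapping.keys p) = mdeg m" "m \<in> Poly_Mapping.keys p" by (rule imageE)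
  then show ?thesis using p by (metis tdeg_def)
qed

lemma tdeg_two_mult_le:
  assumes "Poly_Mapping.keys p \<subseteq> {m. 2 * mdeg m + tdeg G \<le> u}" "Poly_Mapping.keys q \<subseteq> {m. 2 * mdeg m + tdeg G \<le> u}"
  shows "tdeg (p * q * G) \<le> u"
proof (cases "p = 0 \<or> q = 0")
  case False
  then obtain a b where "a \<in> Poly_Mapping.keys p" "mdeg a = tdeg p" "b \<in> Poly_Mapping.keys q" "mdeg b = tdeg q"
    using ex_key_tdeg by metis
  with assms have "2 * tdeg p + tdeg G \<le> u" "2 * tdeg q + tdeg G \<le> u" by auto
  moreover have "tdeg (p * q * G) \<le> tdeg p + tdeg q + tdeg G"
    using tdeg_mult_le[of "p * q" G] tdeg_mult_le[of p q] by simp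
  ultimately show ?thesis by simp
qed auto

text \<open>A functional on \<open>\<real>[X]\<^sub>u\<close> that vanishes on \<open>J\<close>, is nonnegative on the truncated quadratic module, and
  is as strictly positive as this allows: squares modulo \<open>J : G\<^sub>i\<close> have unique representatives supported on
  standard monomials, and for these representatives the squares times \<open>G\<^sub>i\<close> generate a pointed cone modulo \<open>J\<close>.\<close>

lemma ex_strict_functional:
  fixes g :: "'n::finite rpoly list" and u :: nat
  defines "J \<equiv> real_radical (supp_set (Qmod g))"
  defines "G \<equiv> \<lambda>i. (1 # g) ! i"
  shows "\<exists>\<eta>\<in>dual_t u. \<forall>i\<le>length g. \<forall>p. Poly_Mapping.keys p \<subseteq> {m. 2 * mdeg m + tdeg (G i) \<le> u} \<longrightarrow>
    0 \<le> \<eta> (p * p * G i) \<and> (\<eta> (p * p * G i) = 0 \<longrightarrow> p * G i \<in> J)"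
proof -
  note J = is_ideal_real_radical[of g, folded J_def]
  define D :: "nat \<Rightarrow> ('n \<Rightarrow>\<^sub>0 nat) set" where "D i = {m. 2 * mdeg m + tdeg (G i) \<le> u}" for i
  have finD: "finite (D i)" for i
    by (rule finite_subset[OF _ finite_mdeg_le[of u]]) (auto simp: D_def)
  have "\<exists>A\<subseteq>D i. (\<forall>p\<in>{p. p * G i \<in> J}. Poly_Mapping.keys p \<subseteq> A \<longrightarrow> p = 0) \<and>
    (\<forall>p. Poly_Mapping.keys p \<subseteq> D i \<longrightarrow> (\<exists>w. Poly_Mapping.keys w \<subseteq> A \<and> p - w \<in> {p. p * G i \<in> J}))" for i
  proof (rule ex_standard_monomials[OF finD])
    show "0 \<in> {p. p * G i \<in> J}" using is_idealD(1)[OF J] by simp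
    show "p + q \<in> {p. p * G i \<in> J}" if "p \<in> {p. p * G i \<in> J}" "q \<in> {p. p * G i \<in> J}" for p q
      using that is_idealD(2)[OF J] by (simp add: distrib_right)
    show "cpoly c * p \<in> {p. p * G i \<in> J}" if "p \<in> {p. p * G i \<in> J}" for c p
      using that is_idealD(3)[OF J] by (simp add: mult.assoc)
  qed
  then obtain A where A: "\<And>i. A i \<subseteq> D i"
    "\<And>i p. p * G i \<in> J \<Longrightarrow> Poly_Mapping.keys p \<subseteq> A i \<Longrightarrow> p = 0"
    "\<And>i p. Poly_Mapping.keys p \<subseteq> D i \<Longrightarrow> \<exists>w. Poly_Mapping.keys w \<subseteq> A i \<and> (p - w) * G i \<in> J"
    by (simp only: mem_Collect_eq Ball_def) metis
  have finA: "finite (A i)" for i using A(1) finD by (rule finite_subset)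
  obtain B :: "('n \<Rightarrow>\<^sub>0 nat) set" and \<phi> where B: "finite B" "\<And>b. \<phi> b \<in> dual_t u"
    "\<And>p. tdeg p \<le> u \<Longrightarrow> p \<in> J \<longleftrightarrow> (\<forall>b\<in>B. \<phi> b p = 0)"
    using ex_quotient_coordinates[OF J, of u] by blast
  define I where "I = (SIGMA i:{..length g}. A i)"
  define P :: "(nat \<times> ('n \<Rightarrow>\<^sub>0 nat) \<Rightarrow> real) \<Rightarrow> nat \<Rightarrow> 'n rpoly"
    where "P v i = (\<Sum>a\<in>A i. Poly_Mapping.single a (v (i, a)))" for v i
  \<comment> \<open>Block diagonal in the index \<open>i\<close>; the entries are the coordinates
    modulo \<open>J\<close> of a product of two monomials times \<open>G i\<close>. The quadratic
    map of \<open>T\<close> thus sends \<open>v\<close> to the class of the sum of all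
    \<open>P v i * P v i * G i\<close>.\<close>
  define T :: "nat \<times> ('n \<Rightarrow>\<^sub>0 nat) \<Rightarrow> nat \<times> ('n \<Rightarrow>\<^sub>0 nat) \<Rightarrow> ('n \<Rightarrow>\<^sub>0 nat) \<Rightarrow> real"
    where "T x y b = (if fst x = fst y then \<phi> b (Poly_Mapping.single (snd x + snd y) 1 * G (fst x)) else 0)" for x y b
  have lookup_P: "Poly_Mapping.lookup (P v i) a = (if a \<in> A i then v (i, a) else 0)" for v i a
    by (simp add: P_def lookup_sum lookup_single when_def finA)
  have keys_P: "Poly_Mapping.keys (P v i) \<subseteq> A i" for v i
    by (auto simp: in_keys_iff lookup_P split: if_splits)
  have degP: "tdeg (p * p * G i) \<le> u" if "Poly_Mapping.keys p \<subseteq> D i" for p i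
    using that tdeg_two_mult_le[of p "G i" u p] by (simp add: D_def)
  have degPP: "tdeg (P v i * P v i * G i) \<le> u" for v i
    using degP keys_P A(1) by blast
  have quad: "(\<Sum>x\<in>I. \<Sum>y\<in>I. v x * v y * T x y b) = (\<Sum>i\<le>length g. \<phi> b (P v i * P v i * G i))" for v b
  proof -
    have deg1: "tdeg (Poly_Mapping.single (a + a') 1 * G i) \<le> u" if "a \<in> A i" "a' \<in> A i" for i a a'
      using tdeg_two_mult_le[of "Poly_Mapping.single a 1" "G i" u "Poly_Mapping.single a' 1"] that A(1)[of i]
      by (auto simp: D_def mult_single)
    have block: "\<phi> b (P v i * P v i * G i) =
      (\<Sum>a\<in>A i. \<Sum>a'\<in>A i. v (i, a) * v (i, a') * \<phi> b (Poly_Mapping.single (a + a') 1 * G i))" for i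
    proof -
      have "P v i * P v i * G i =
        (\<Sum>a\<in>A i. \<Sum>a'\<in>A i. cpoly (v (i, a) * v (i, a')) * (Poly_Mapping.single (a + a') 1 * G i))"
      proof -
        have "P v i * P v i = (\<Sum>a\<in>A i. \<Sum>a'\<in>A i. Poly_Mapping.single (a + a') (v (i, a) * v (i, a')))"
          by (simp add: P_def sum_product mult_single)
        also have "\<dots> * G i = (\<Sum>a\<in>A i. \<Sum>a'\<in>A i. Poly_Mapping.single (a + a') (v (i, a) * v (i, a')) * G i)"
          by (simp only: sum_distrib_right)
        finally show ?thesis by (simp add: mult.assoc[symmetric] cpoly_mult_single)
      qed
      also have "\<phi> b \<dots> = (\<Sum>a\<in>A i. \<phi> b (\<Sum>a'\<in>A i. cpoly (v (i, a) * v (i, a')) * (Poly_Mapping.single (a + a') 1 * G i)))"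
        by (intro dual_t_sum[OF B(2)] tdeg_sum_le order_trans[OF tdeg_cpoly_mult_le] deg1)
      also have "\<dots> = (\<Sum>a\<in>A i. \<Sum>a'\<in>A i. \<phi> b (cpoly (v (i, a) * v (i, a')) * (Poly_Mapping.single (a + a') 1 * G i)))"
        by (intro sum.cong refl dual_t_sum[OF B(2)] order_trans[OF tdeg_cpoly_mult_le] deg1)
      also have "\<dots> = (\<Sum>a\<in>A i. \<Sum>a'\<in>A i. v (i, a) * v (i, a') * \<phi> b (Poly_Mapping.single (a + a') 1 * G i))"
        by (intro sum.cong refl dual_t_scale[OF B(2)] deg1)
      finally show ?thesis .
    qed
    have SI: "(\<Sum>x\<in>I. f x) = (\<Sum>i\<le>length g. \<Sum>a\<in>A i. f (i, a))" for f :: "_ \<Rightarrow> real"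
      unfolding I_def using finA by (simp add: sum.Sigma)
    have inner: "(\<Sum>y\<in>I. v (i, a) * v y * T (i, a) y b) =
        (\<Sum>a'\<in>A i. v (i, a) * v (i, a') * \<phi> b (Poly_Mapping.single (a + a') 1 * G i))"
      if "i \<le> length g" for i a
    proof -
      have "(\<Sum>y\<in>I. v (i, a) * v y * T (i, a) y b) = (\<Sum>i'\<le>length g. if i' = i then
          (\<Sum>a'\<in>A i. v (i, a) * v (i, a') * \<phi> b (Poly_Mapping.single (a + a') 1 * G i)) else 0)"
        unfolding SI by (intro sum.cong refl) (auto simp: T_def)
      then show ?thesis using that by simp
    qed
    show ?thesis unfolding SI[of "\<lambda>x. \<Sum>y\<in>I. v x * v y * T x y b"] block
      by (intro sum.cong refl) (simp add: inner)
  qed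
  have GQ: "p * p * G i \<in> Qmod g" if "i \<le> length g" for p i
  proof (cases i)
    case 0
    then show ?thesis by (simp add: G_def Qmod_sos is_sos_square)
  next
    case (Suc j)
    then show ?thesis using that by (simp add: G_def Qmod_mult_square Qmod_generator)
  qed
  have "\<exists>\<sigma>. \<forall>v. (\<exists>x\<in>I. v x \<noteq> 0) \<longrightarrow> 0 < (\<Sum>b\<in>B. \<sigma> b * (\<Sum>x\<in>I. \<Sum>y\<in>I. v x * v y * T x y b))"
  proof (rule strictly_positive_functional)
    show "finite I" unfolding I_def using finA by (intro finite_SigmaI) auto
    show "finite B" by (rule B(1))
    fix n :: nat and v :: "nat \<Rightarrow> nat \<times> ('n \<Rightarrow>\<^sub>0 nat) \<Rightarrow> real"
    assume zero: "\<And>b. b \<in> B \<Longrightarrow> (\<Sum>j<n. \<Sum>x\<in>I. \<Sum>y\<in>I. v j x * v j y * T x y b) = 0"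
    define X where "X = {..<n} \<times> {..length g}"
    define q where "q = (\<lambda>(j, i). P (v j) i * P (v j) i * G i)"
    have dq: "tdeg (q x) \<le> u" for x using degPP by (simp add: q_def split: prod.split)
    have "\<phi> b (\<Sum>x\<in>X. q x) = 0" if "b \<in> B" for b
    proof -
      have "\<phi> b (\<Sum>x\<in>X. q x) = (\<Sum>x\<in>X. \<phi> b (q x))" by (rule dual_t_sum[OF B(2) dq])
      also have "\<dots> = (\<Sum>j<n. \<Sum>i\<le>length g. \<phi> b (P (v j) i * P (v j) i * G i))"
        by (simp add: X_def q_def sum.cartesian_product case_prod_beta)
      also have "\<dots> = 0" using zero[OF that] unfolding quad .
      finally show ?thesis .
    qed
    moreover have "tdeg (\<Sum>x\<in>X. q x) \<le> u" by (rule tdeg_sum_le[OF dq])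
    ultimately have "(\<Sum>x\<in>X. q x) \<in> J" using B(3) by blast
    \<comment> \<open>All summands lie in the quadratic module, so convexity of \<open>J\<close>
      passes from the sum to each of them.\<close>
    then have qJ: "q x \<in> J" if "x \<in> X" for x
      unfolding J_def
      by (rule real_radical_convex_sum[rotated 2]) (use that GQ in \<open>auto simp: X_def q_def\<close>)
    show "\<forall>j<n. \<forall>x\<in>I. v j x = 0"
    proof (intro allI impI ballI)
      fix j x assume j: "j < n" and "x \<in> I"
      then obtain i a where x: "x = (i, a)" "i \<le> length g" "a \<in> A i" by (auto simp: I_def)
      have "P (v j) i * P (v j) i * G i \<in> J" using qJ[of "(j, i)"] j x(2) by (simp add: X_def q_def)
      \<comment> \<open>A second factor \<open>G i\<close> completes the square of
        \<open>P (v j) i * G i\<close>; its root lies in \<open>J\<close>, and a standard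
        representative with this property is zero.\<close>
      then have "(P (v j) i * P (v j) i * G i) * G i \<in> J" by (rule is_idealD(4)[OF J])
      moreover have "(P (v j) i * P (v j) i * G i) * G i = (P (v j) i * G i) * (P (v j) i * G i)"
        by (simp only: mult_ac)
      ultimately have "P (v j) i * G i \<in> J" using real_radical_square_cancel unfolding J_def by metis
      then have "P (v j) i = 0" using A(2) keys_P by blast
      then show "v j x = 0" using lookup_P[of "v j" i a] x by simp
    qed
  qed
  then obtain \<sigma> where \<sigma>: "\<And>v. \<exists>x\<in>I. v x \<noteq> 0 \<Longrightarrow> 0 < (\<Sum>b\<in>B. \<sigma> b * (\<Sum>x\<in>I. \<Sum>y\<in>I. v x * v y * T x y b))"
    by blast
  define \<eta> where "\<eta> p = (\<Sum>b\<in>B. \<sigma> b * \<phi> b p)" for p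
  have \<eta>: "\<eta> \<in> dual_t u"
    using B(2) unfolding dual_t_def \<eta>_def
    by (auto simp: distrib_left sum.distrib sum_distrib_left mult_ac)
  have \<eta>J: "\<eta> p = 0" if "p \<in> J" "tdeg p \<le> u" for p
    using B(3)[OF that(2)] that(1) by (simp add: \<eta>_def)
  have pos: "\<eta> (w * w * G i) > 0" if w: "Poly_Mapping.keys w \<subseteq> A i" "w \<noteq> 0" "i \<le> length g" for w i
  proof -
    define v where "v x = (if fst x = i then Poly_Mapping.lookup w (snd x) else 0)" for x :: "nat \<times> ('n \<Rightarrow>\<^sub>0 nat)"
    have Pi: "P v i = w"
      using w(1) by (intro poly_mapping_eqI) (auto simp: lookup_P v_def in_keys_iff)
    have Pj: "P v j = 0" if "j \<noteq> i" for j
      using that by (simp add: P_def v_def)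
    have "(\<Sum>j\<le>length g. \<phi> b (P v j * P v j * G j)) = (\<Sum>j\<le>length g. if j = i then \<phi> b (w * w * G i) else 0)" for b
    proof (intro sum.cong refl)
      fix j
      have "\<phi> b 0 = 0" using dual_t_scale[OF B(2), of 0 b 0] by simp
      then show "\<phi> b (P v j * P v j * G j) = (if j = i then \<phi> b (w * w * G i) else 0)"
        using Pi Pj by simp
    qed
    then have eq: "(\<Sum>j\<le>length g. \<phi> b (P v j * P v j * G j)) = \<phi> b (w * w * G i)" for b
      using w(3) by simp
    obtain a where a: "a \<in> Poly_Mapping.keys w" using w(2) by (metis keys_eq_empty ex_in_conv)
    then have "(i, a) \<in> I" "v (i, a) \<noteq> 0"
      using w by (auto simp: I_def v_def in_keys_iff)
    then have "0 < (\<Sum>b\<in>B. \<sigma> b * (\<Sum>x\<in>I. \<Sum>y\<in>I. v x * v y * T x y b))" using \<sigma> by blast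
    then show ?thesis by (simp add: quad eq \<eta>_def)
  qed
  have main: "0 \<le> \<eta> (p * p * G i) \<and> (\<eta> (p * p * G i) = 0 \<longrightarrow> p * G i \<in> J)"
    if i: "i \<le> length g" and p: "Poly_Mapping.keys p \<subseteq> D i" for i p
  proof -
    obtain w where w: "Poly_Mapping.keys w \<subseteq> A i" "(p - w) * G i \<in> J" using A(3)[OF p] by blast
    \<comment> \<open>This difference of squares lies in \<open>J\<close>, so \<open>\<eta>\<close>
      agrees on \<open>p * p * G i\<close> and \<open>w * w * G i\<close>.\<close>
    define e where "e = (p - w) * G i * (p + w)"
    have eJ: "e \<in> J" unfolding e_def using w(2) by (rule is_idealD(4)[OF J])
    have e: "e = p * p * G i - w * w * G i" by (simp add: e_def algebra_simps)
    have dw: "tdeg (w * w * G i) \<le> u" using w(1) A(1) by (intro degP) blast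
    have de: "tdeg e \<le> u" unfolding e using degP[OF p] dw by (rule tdeg_diff_le)
    have "\<eta> (e + w * w * G i) = \<eta> e + \<eta> (w * w * G i)" by (rule dual_t_add[OF \<eta> de dw])
    then have eq: "\<eta> (p * p * G i) = \<eta> (w * w * G i)" using \<eta>J[OF eJ de] by (simp add: e)
    show ?thesis
    proof (cases "w = 0")
      case True
      have "\<eta> 0 = 0" using \<eta>J[of 0] is_idealD(1)[OF J] by simp
      then show ?thesis using eq w(2) True by simp
    next
      case False
      then show ?thesis using eq pos[OF w(1) False i] by simp
    qed
  qed
  show ?thesis
    using \<eta> main unfolding D_def by blast
qed

text \<open>Index \<open>0\<close>, where the factor is \<open>1\<close>, gives the strictness; all
  indices together give nonnegativity. Top degrees in a sum of squares cannot cancel, so the degree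
  bound on a multiplier passes to each polynomial squared in it, as
  \<open>ex_strict_functional\<close> demands.\<close>

lemma ex_strict_Lcone_functional:
  fixes g :: "'n::finite rpoly list"
  shows "\<exists>\<eta>\<in>Lcone_t (2 * k) g. \<forall>f. tdeg f \<le> k \<longrightarrow> \<eta> (f * f) = 0 \<longrightarrow> f \<in> real_radical (supp_set (Qmod g))"
proof -
  define G where "G i = (1 # g) ! i" for i
  obtain \<eta> where \<eta>: "\<eta> \<in> dual_t (2 * k)" and
    pos: "\<And>i p. i \<le> length g \<Longrightarrow> Poly_Mapping.keys p \<subseteq> {m. 2 * mdeg m + tdeg (G i) \<le> 2 * k} \<Longrightarrow>
      0 \<le> \<eta> (p * p * G i) \<and> (\<eta> (p * p * G i) = 0 \<longrightarrow> p * G i \<in> real_radical (supp_set (Qmod g)))"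
    using ex_strict_functional[of "2 * k" g] unfolding G_def by blast
  have keys: "Poly_Mapping.keys p \<subseteq> {m. 2 * mdeg m + tdeg (G i) \<le> 2 * k}"
    if "2 * tdeg p + tdeg (G i) \<le> 2 * k" for p i
    using that tdeg_le_iff[of p "tdeg p"] by fastforce
  have nonneg: "0 \<le> \<eta> (s * G i) \<and> tdeg (s * G i) \<le> 2 * k"
    if s: "is_sos s" "s = 0 \<or> tdeg s + tdeg (G i) \<le> 2 * k" and i: "i \<le> length g" for s i
  proof (cases "s = 0")
    case True
    then show ?thesis using dual_t_scale[OF \<eta>, of 0 0] by simp
  next
    case False
    obtain n :: nat and p where p: "s = (\<Sum>j<n. p j * p j)" using s(1) by (auto simp: is_sos_iff)
    have kp: "Poly_Mapping.keys (p j) \<subseteq> {m. 2 * mdeg m + tdeg (G i) \<le> 2 * k}" if "j < n" for j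
      using tdeg_sum_squares_ge[OF that, of p] False s(2) p by (intro keys) simp
    have sG: "s * G i = (\<Sum>j<n. p j * p j * G i)" by (simp add: p sum_distrib_right)
    have "\<eta> (s * G i) = (\<Sum>j<n. \<eta> (p j * p j * G i))"
      unfolding sG by (rule dual_t_sum[OF \<eta>]) (use kp in \<open>auto intro: tdeg_two_mult_le\<close>)
    moreover have "\<dots> \<ge> 0" using pos[OF i kp] by (intro sum_nonneg) simp
    moreover have "tdeg (s * G i) \<le> 2 * k"
      unfolding sG by (intro tdeg_sum_le tdeg_two_mult_le kp) auto
    ultimately show ?thesis by simp
  qed
  have "\<eta> q \<ge> 0" if q: "q \<in> Qmod_t (2 * k) g" for q
  proof -
    obtain s0 s where s: "is_sos s0" "tdeg s0 \<le> 2 * k" "q = s0 + (\<Sum>i<length g. s i * g ! i)"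
      "\<And>i. i < length g \<Longrightarrow> is_sos (s i)"
      "\<And>i. i < length g \<Longrightarrow> s i = 0 \<or> tdeg (s i) + tdeg (g ! i) \<le> 2 * k"
      using q unfolding Qmod_t_def by blast
    have s0: "0 \<le> \<eta> s0" using nonneg[of s0 0] s(1,2) by (simp add: G_def)
    have si: "0 \<le> \<eta> (s i * g ! i)" "tdeg (s i * g ! i) \<le> 2 * k" if "i < length g" for i
      using nonneg[of "s i" "Suc i"] s(4,5)[OF that] that by (auto simp: G_def)
    have "\<eta> q = \<eta> s0 + \<eta> (\<Sum>i<length g. s i * g ! i)"
      unfolding s(3) by (intro dual_t_add[OF \<eta>] s(2) tdeg_sum_le si(2)) simp
    moreover have "\<eta> (\<Sum>i<length g. s i * g ! i) = (\<Sum>i<length g. \<eta> (s i * g ! i))"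
      by (intro dual_t_sum[OF \<eta>] si(2)) simp
    moreover have "(\<Sum>i<length g. \<eta> (s i * g ! i)) \<ge> 0" using si(1) by (intro sum_nonneg) simp
    ultimately show ?thesis using s0 by simp
  qed
  then have "\<eta> \<in> Lcone_t (2 * k) g" using \<eta> by (simp add: Lcone_t_def)
  moreover have "f \<in> real_radical (supp_set (Qmod g))" if "tdeg f \<le> k" "\<eta> (f * f) = 0" for f
    using pos[of 0 f] keys[of f 0] that by (simp add: G_def)
  ultimately show ?thesis by blast
qed

subsection \<open>Kernels of Hankel operators\<close>

lemma square_in_Qmod_t: "tdeg p \<le> k \<Longrightarrow> p * p \<in> Qmod_t (2 * k) G"
  unfolding Qmod_t_def
proof (rule CollectI, rule exI[of _ "p * p"], rule exI[of _ "\<lambda>_. 0"], intro conjI)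
  assume "tdeg p \<le> k"
  then show "tdeg (p * p) \<le> 2 * k" using tdeg_mult_le[of p p] by simp
qed (simp_all add: is_sos_0 is_sos_square)

text \<open>Degenerate Cauchy-Schwarz: the value at the square of \<open>t * p + q\<close> is affine
  in \<open>t\<close> and nonnegative for every real \<open>t\<close>.\<close>

lemma Lcone_t_square_zero:
  assumes \<sigma>: "\<sigma> \<in> Lcone_t (2 * k) G" and p: "tdeg p \<le> k" and q: "tdeg q \<le> k" and zero: "\<sigma> (p * p) = 0"
  shows "\<sigma> (p * q) = 0"
proof (rule nonneg_affine_imp_slope_zero)
  fix t :: real
  have \<sigma>': "\<sigma> \<in> dual_t (2 * k)" using \<sigma> by (simp add: Lcone_t_def)
  have deg: "tdeg (a * b) \<le> 2 * k" if "tdeg a \<le> k" "tdeg b \<le> k" for a b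
    using tdeg_mult_le[of a b] that by simp
  define r where "r = cpoly t * p + q"
  have r: "tdeg r \<le> k"
    unfolding r_def using p q by (intro tdeg_add_le order_trans[OF tdeg_cpoly_mult_le])
  have "r * r = cpoly (t * t) * (p * p) + (cpoly (2 * t) * (p * q) + q * q)"
    unfolding r_def mult_2 cpoly_add cpoly_mult by (simp add: algebra_simps)
  also have "\<sigma> \<dots> = \<sigma> (cpoly (t * t) * (p * p)) + (\<sigma> (cpoly (2 * t) * (p * q)) + \<sigma> (q * q))"
  proof -
    have "tdeg (cpoly (t * t) * (p * p)) \<le> 2 * k" "tdeg (cpoly (2 * t) * (p * q)) \<le> 2 * k" "tdeg (q * q) \<le> 2 * k"
      using p q by (auto intro: deg order_trans[OF tdeg_cpoly_mult_le])
    then show ?thesis by (simp add: dual_t_add[OF \<sigma>'] tdeg_add_le)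
  qed
  also have "\<dots> = 2 * t * \<sigma> (p * q) + \<sigma> (q * q)"
    using p q by (simp add: dual_t_scale[OF \<sigma>'] deg zero)
  finally show "0 \<le> 2 * t * \<sigma> (p * q) + \<sigma> (q * q)"
    using \<sigma> square_in_Qmod_t[OF r] unfolding Lcone_t_def by fastforce
qed

text \<open>Each step halves the exponent by testing the square root of the current power against
  \<open>1\<close>. The descent stops at exponent two, hence \<open>Suc e\<close>.\<close>

lemma Lcone_t_power_zero:
  assumes \<sigma>: "\<sigma> \<in> Lcone_t (2 * k) G"
  shows "2 ^ Suc e * tdeg p \<le> 2 * k \<Longrightarrow> \<sigma> (p ^ (2 ^ Suc e)) = 0 \<Longrightarrow> \<sigma> (p * p) = 0"
proof (induction e)
  case 0
  have "p ^ (2 ^ Suc 0) = p * p" by (simp add: power2_eq_square)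
  with 0(2) show ?case by metis
next
  case (Suc e)
  define q where "q = p ^ (2 ^ Suc e)"
  have "2 ^ Suc e * tdeg p \<le> k" using Suc.prems(1) by (simp add: mult_ac)
  then have "tdeg q \<le> k" unfolding q_def by (rule order_trans[OF tdeg_power_le])
  moreover have "q * q = p ^ (2 ^ Suc (Suc e))" unfolding q_def power_add[symmetric] by simp
  then have "\<sigma> (q * q) = 0" using Suc.prems(2) by metis
  ultimately have "\<sigma> (q * 1) = 0" using Lcone_t_square_zero[OF \<sigma>, of q 1] by simp
  then have "\<sigma> (p ^ (2 ^ Suc e)) = 0" by (simp only: q_def mult_1_right)
  moreover have "2 ^ Suc e * tdeg p \<le> 2 * k" using Suc.prems(1) by (simp add: mult_ac)
  ultimately show ?case by (rule Suc.IH[rotated])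
qed

text \<open>The exponent \<open>2 ^ Suc n\<close> is at least \<open>n\<close>, so the power lies in
  the support, and it is even, so the power is a square; both signs force \<open>\<sigma>\<close> to
  vanish on it. As \<open>k0\<close> is independent of \<open>\<sigma>\<close> and \<open>t\<close>,
  finitely many generators can share one pair of degrees.\<close>

lemma real_radical_subset_hankel_ker:
  assumes f: "f \<in> real_radical (supp_set (Qmod G))"
  shows "\<exists>k0. \<forall>k\<ge>k0. \<forall>\<sigma>\<in>Lcone_t (2 * k) G. \<forall>t\<ge>tdeg f. t \<le> k \<longrightarrow> f \<in> hankel_ker t \<sigma>"
proof -
  obtain n where "f ^ n \<in> supp_set (Qmod G)" using f unfolding mem_real_radical_supp by blast
  then have "f ^ (2 ^ Suc n) \<in> supp_set (Qmod G)"
    by (rule is_ideal_power_mono[OF is_ideal_supp])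
      (use less_exp[of "Suc n"] in linarith)
  then have "- (f ^ (2 ^ Suc n)) \<in> Qmod G" by (simp add: mem_supp_set)
  then obtain t0 where t0: "- (f ^ (2 ^ Suc n)) \<in> Qmod_t t0 G" by (auto simp: Qmod_def)
  \<comment> \<open>The first summand covers the truncation level of the certificate, the second the
    degree of the power.\<close>
  define k0 where "k0 = t0 + 2 ^ Suc n * tdeg f"
  have "f \<in> hankel_ker t \<sigma>" if k: "k0 \<le> k" and \<sigma>: "\<sigma> \<in> Lcone_t (2 * k) G" and t: "tdeg f \<le> t" "t \<le> k" for k \<sigma> t
  proof -
    have \<sigma>': "\<sigma> \<in> dual_t (2 * k)" using \<sigma> by (simp add: Lcone_t_def)
    have deg: "2 ^ Suc n * tdeg f \<le> 2 * k" using k by (simp add: k0_def)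
    have "- (f ^ (2 ^ Suc n)) \<in> Qmod_t (2 * k) G"
      using t0 Qmod_t_mono[of t0 "2 * k" G] k by (auto simp: k0_def)
    then have "\<sigma> (- (f ^ (2 ^ Suc n))) \<ge> 0" using \<sigma> unfolding Lcone_t_def by blast
    moreover have "\<sigma> (- (f ^ (2 ^ Suc n))) = - \<sigma> (f ^ (2 ^ Suc n))"
      by (rule dual_t_uminus[OF \<sigma>' order_trans[OF tdeg_power_le deg]])
    moreover have "\<sigma> (f ^ (2 ^ Suc n)) \<ge> 0"
    proof -
      have "tdeg (f ^ 2 ^ n) \<le> k" using tdeg_power_le[of f "2 ^ n"] deg by simp
      then have "f ^ 2 ^ n * f ^ 2 ^ n \<in> Qmod_t (2 * k) G" by (rule square_in_Qmod_t)
      moreover have "f ^ 2 ^ n * f ^ 2 ^ n = f ^ (2 ^ Suc n)" by (simp add: power_add[symmetric] mult_2)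
      ultimately show ?thesis using \<sigma> unfolding Lcone_t_def by auto
    qed
    ultimately have "\<sigma> (f ^ (2 ^ Suc n)) = 0" by simp
    then have "\<sigma> (f * f) = 0" by (rule Lcone_t_power_zero[OF \<sigma> deg])
    then show ?thesis
      unfolding hankel_ker_def polys_le_def using t Lcone_t_square_zero[OF \<sigma>, of f] by auto
  qed
  then show ?thesis by blast
qed

section \<open>Choice of the degrees and the two inclusions\<close>

theorem mainTheorem2:
  fixes g :: "'n::finite rpoly list"
  shows "\<exists>t k::nat. t \<le> k \<and>
    (\<forall>\<sigma>. generic_in k (Lcone_t (2 * k) g) \<sigma> \<longrightarrow>
         ideal_gen (hankel_ker t \<sigma>) = real_radical (supp_set (Qmod g)))"
proof -
  define J where "J = real_radical (supp_set (Qmod g))"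
  have J: "is_ideal J" unfolding J_def by (rule is_ideal_real_radical)
  obtain F where F: "finite F" "F \<subseteq> J" "ideal_gen F = J" using hilbert_basis[OF J] by blast
  have "\<forall>f\<in>F. \<exists>k0. \<forall>k\<ge>k0. \<forall>\<sigma>\<in>Lcone_t (2 * k) g. \<forall>t\<ge>tdeg f. t \<le> k \<longrightarrow> f \<in> hankel_ker t \<sigma>"
    using F(2) real_radical_subset_hankel_ker unfolding J_def by blast
  then obtain K where K: "\<And>f k \<sigma> t. f \<in> F \<Longrightarrow> K f \<le> k \<Longrightarrow> \<sigma> \<in> Lcone_t (2 * k) g \<Longrightarrow> tdeg f \<le> t \<Longrightarrow> t \<le> k
      \<Longrightarrow> f \<in> hankel_ker t \<sigma>" by metis
  \<comment> \<open>Sums serve as upper bounds that also make sense for empty \<open>F\<close>; the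
    summand \<open>t\<close> in \<open>k\<close> ensures \<open>t \<le> k\<close>.\<close>
  define t where "t = (\<Sum>f\<in>F. tdeg f)"
  define k where "k = t + (\<Sum>f\<in>F. K f)"
  have "ideal_gen (hankel_ker t \<sigma>) = J" if gen: "generic_in k (Lcone_t (2 * k) g) \<sigma>" for \<sigma>
  proof
    have \<sigma>: "\<sigma> \<in> Lcone_t (2 * k) g" using gen by (simp add: generic_in_def)
    obtain \<eta> where \<eta>: "\<eta> \<in> Lcone_t (2 * k) g" "\<And>f. tdeg f \<le> k \<Longrightarrow> \<eta> (f * f) = 0 \<Longrightarrow> f \<in> J"
      using ex_strict_Lcone_functional[of k g] unfolding J_def by blast
    \<comment> \<open>Genericity is applied at level \<open>t\<close> against \<open>\<eta>\<close>;
      testing an element of the kernel of \<open>\<eta>\<close> against itself puts it into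
      \<open>J\<close>.\<close>
    have "hankel_ker t \<sigma> \<subseteq> hankel_ker t \<eta>"
      using gen \<eta>(1) by (auto simp: generic_in_def k_def)
    also have "\<dots> \<subseteq> J"
      using \<eta>(2) by (auto simp: hankel_ker_def polys_le_def k_def)
    finally show "ideal_gen (hankel_ker t \<sigma>) \<subseteq> J" by (rule ideal_gen_subset[OF J])
    have "F \<subseteq> hankel_ker t \<sigma>"
    proof
      fix f assume f: "f \<in> F"
      have "tdeg f \<le> t" "K f \<le> (\<Sum>f\<in>F. K f)"
        unfolding t_def using f F(1) by (auto intro: member_le_sum)
      then show "f \<in> hankel_ker t \<sigma>" using f \<sigma> by (intro K[of f k]) (auto simp: k_def)
    qed
    then have "F \<subseteq> ideal_gen (hankel_ker t \<sigma>)" using ideal_gen_superset by blast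
    then show "J \<subseteq> ideal_gen (hankel_ker t \<sigma>)"
      using ideal_gen_subset[OF is_ideal_ideal_gen] F(3) by blast
  qed
  then show ?thesis unfolding J_def by (intro exI[of _ t] exI[of _ k]) (simp add: k_def)
qed

end
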